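(* Consider the sparse sequence model with independent $X_i\sim f_{\theta_i}$, $1\le i\le n$, in the asymptotics $n\to\infty$, $s_n\to\infty$, $n/s_n\to\infty$, and suppose Assumption 1 (stated in the context) holds, with sequences $a_n^*,\delta_n$. Let $\boldsymbol a=(a_1,\dots,a_{s_n})$ be a vector (implicitly indexed by $n$) with $a_j>0$ for all $j$, let $$\Theta(\boldsymbol a,s_n)=\{\theta\in\ell_0[s_n]:\ \exists\, i_1,\dots,i_{s_n}\ \text{all distinct},\ |\theta_{i_j}|\ge a_j,\ 1\le j\le s_n\},$$ and let $\Lambda_n(\boldsymbol a)=s_n^{-1}\sum_{j=1}^{s_n}F_{a_j}(a_n^* )$. Then: - under Assumption 1.A, $\displaystyle\inf_\varphi\sup_{\theta\in\Theta(\boldsymbol a,s_n)}\mathfrak R(\theta,\varphi)=\Lambda_n(\boldsymbol a)+o(1)$; - under Assumption 1.B, $\displaystyle\inf_\varphi\sup_{\theta\in\Theta(\boldsymbol a,s_n)}\mathfrak R(\theta,\varphi)=2\Lambda_n(\boldsymbol a)-1+o(1)$. Here the infimum is over all multiple testing procedures. In each case the risk bound is achieved by a thresholding procedure $\varphi_i(X)=\mathbf 1\{|X_i|>a_n^*\}$ with $a_n^*$ as in Assumption 1.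
   Context: Model: $(f_a:a\in\mathbb R)$ is a family of probability densities on $\mathbb R$, $F_a(x)=\int_{-\infty}^xf_a(t)\,dt$, $\overline F_a=1-F_a$. For $\theta\in\mathbb R^n$ deterministic, the observations $X_1,\dots,X_n$ are independent with $X_i\sim f_{\theta_i}$; $P_\theta,E_\theta$ denote the law and expectation. $(s_n)$ is a sequence of integers. $\ell_0[s]=\{\theta\in\mathbb R^n:\#\{i:\theta_i\ne0\}\le s\}$. Assumption 1. There is a constant $L$ such that each $F_a$ is $L$-Lipschitz. There exist sequences of positive numbers $a_n^*\to\infty$, $\delta_n\to0$ such that $(n/s_n)\overline F_0(a_n^*-\delta_n)\to\infty$ and $(n/s_n)\overline F_0(a_n^* )\to0$. The density $f_0$ is continuous and positive on $\mathbb R$. Further, one of the following holds: (A) $f_{-a}(-x)=f_a(x)$ for all $a,x\in\mathbb R$; $\overline F_a(x)$ is increasing in $a\in\mathbb R$; and for $a>0$, $f_a(x)/f_0(x)$ is increasing in $x\in\mathbb R$. (B) $f_a(-x)=f_a(x)$ for all $a,x\in\mathbb R$; $\overline F_a(x)$ is increasing in $a>0$ for $x>0$; and for $a\ne0$, $f_a(x)/f_0(x)$ is increasing in $x>0$. "Assumption 1.A" (resp. "1.B") means Assumption 1 with (A) (resp. (B)). A multiple testing procedure is a measurable $\varphi:\mathbb R^n\to\{0,1\}^n$ (depending on $n$). $\mathrm{FDR}(\theta,\varphi)=E_\theta\left[\frac{\sum_i\mathbf 1\{\theta_i=0\}\varphi_i(X)}{1\vee\sum_i\varphi_i(X)}\right]$,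 $\mathrm{FNR}(\theta,\varphi)=E_\theta\left[\frac{\sum_i\mathbf 1\{\theta_i\ne0\}(1-\varphi_i(X))}{1\vee\sum_i\mathbf 1\{\theta_i\ne0\}}\right]$, $\mathfrak R=\mathrm{FDR}+\mathrm{FNR}$.
   Formalization: Attainment by threshold a_n^* is shown along n with Λ_n(a) ≤ c, any c<1 (it can fail if Λ_n→1; some other thresholds attain the bound always); under 1.B it is also assumed that F̄_a(x) ≤ F̄_{-a}(x) for a,x>0, without which the claim is false. *)

theory Defs
  imports "HOL-Probability.Probability"
begin

definition density_family :: "(real \<Rightarrow> real \<Rightarrow> real) \<Rightarrow> bool" where
  "density_family f \<longleftrightarrow>
     (\<forall>a. f a \<in> borel_measurable borel \<and> (\<forall>x. 0 \<le> f a x) \<and>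
          integrable lborel (f a) \<and> integral\<^sup>L lborel (f a) = 1)"

definition dist_fun :: "(real \<Rightarrow> real \<Rightarrow> real) \<Rightarrow> real \<Rightarrow> real \<Rightarrow> real" where
  "dist_fun f a x = (LINT t:{..x}|lborel. f a t)"

definition surv_fun :: "(real \<Rightarrow> real \<Rightarrow> real) \<Rightarrow> real \<Rightarrow> real \<Rightarrow> real" where
  "surv_fun f a x = 1 - dist_fun f a x"

text \<open>A vector in n-dimensional space is an extensional function on \<open>{1..n}\<close>.\<close>

definition law :: "(real \<Rightarrow> real \<Rightarrow> real) \<Rightarrow> nat \<Rightarrow> (nat \<Rightarrow> real) \<Rightarrow> (nat \<Rightarrow> real) measure" where
  "law f n \<theta> = (\<Pi>\<^sub>M i\<in>{1..n}. density lborel (f (\<theta> i)))"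

definition sparse_vectors :: "nat \<Rightarrow> nat \<Rightarrow> (nat \<Rightarrow> real) set" where
  "sparse_vectors n k = {\<theta> \<in> {1..n} \<rightarrow>\<^sub>E UNIV. card {i\<in>{1..n}. \<theta> i \<noteq> 0} \<le> k}"

definition signal_class :: "nat \<Rightarrow> nat \<Rightarrow> (nat \<Rightarrow> real) \<Rightarrow> (nat \<Rightarrow> real) set" where
  "signal_class n k a =
     {\<theta> \<in> sparse_vectors n k.
        \<exists>i. inj_on i {1..k} \<and> i ` {1..k} \<subseteq> {1..n} \<and> (\<forall>j\<in>{1..k}. a j \<le> \<bar>\<theta> (i j)\<bar>)}"

definition testing_procedures :: "nat \<Rightarrow> ((nat \<Rightarrow> real) \<Rightarrow> nat \<Rightarrow> nat) set" where
  "testing_procedures n =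
     measurable (\<Pi>\<^sub>M i\<in>{1..n}. (borel :: real measure)) (\<Pi>\<^sub>M i\<in>{1..n}. count_space {0, 1})"

definition threshold_procedure :: "nat \<Rightarrow> real \<Rightarrow> (nat \<Rightarrow> real) \<Rightarrow> nat \<Rightarrow> nat" where
  "threshold_procedure n t x = (\<lambda>i\<in>{1..n}. if \<bar>x i\<bar> > t then 1 else 0)"

definition FDR ::
    "(real \<Rightarrow> real \<Rightarrow> real) \<Rightarrow> nat \<Rightarrow> (nat \<Rightarrow> real) \<Rightarrow> ((nat \<Rightarrow> real) \<Rightarrow> nat \<Rightarrow> nat) \<Rightarrow> real" where
  "FDR f n \<theta> \<phi> =
     (LINT x|law f n \<theta>. (\<Sum>i=1..n. of_bool (\<theta> i = 0) * real (\<phi> x i))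
                        / max 1 (\<Sum>i=1..n. real (\<phi> x i)))"

definition FNR ::
    "(real \<Rightarrow> real \<Rightarrow> real) \<Rightarrow> nat \<Rightarrow> (nat \<Rightarrow> real) \<Rightarrow> ((nat \<Rightarrow> real) \<Rightarrow> nat \<Rightarrow> nat) \<Rightarrow> real" where
  "FNR f n \<theta> \<phi> =
     (LINT x|law f n \<theta>. (\<Sum>i=1..n. of_bool (\<theta> i \<noteq> 0) * (1 - real (\<phi> x i)))
                        / max 1 (\<Sum>i=1..n. of_bool (\<theta> i \<noteq> 0)))"

definition multiple_risk ::
    "(real \<Rightarrow> real \<Rightarrow> real) \<Rightarrow> nat \<Rightarrow> (nat \<Rightarrow> real) \<Rightarrow> ((nat \<Rightarrow> real) \<Rightarrow> nat \<Rightarrow> nat) \<Rightarrow> real" where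
  "multiple_risk f n \<theta> \<phi> = FDR f n \<theta> \<phi> + FNR f n \<theta> \<phi>"

text \<open>
  The risk of a procedure lies in [0,2], so the real-valued supremum and infimum below are the
  genuine ones as soon as the class of parameters is nonempty, that is, for \<open>k \<le> n\<close>.
\<close>

definition worst_risk ::
    "(real \<Rightarrow> real \<Rightarrow> real) \<Rightarrow> nat \<Rightarrow> (nat \<Rightarrow> real) set \<Rightarrow> ((nat \<Rightarrow> real) \<Rightarrow> nat \<Rightarrow> nat) \<Rightarrow> real" where
  "worst_risk f n \<Theta> \<phi> = (SUP \<theta>\<in>\<Theta>. multiple_risk f n \<theta> \<phi>)"

definition minimax_risk ::
    "(real \<Rightarrow> real \<Rightarrow> real) \<Rightarrow> nat \<Rightarrow> (nat \<Rightarrow> real) set \<Rightarrow> real" where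
  "minimax_risk f n \<Theta> = (INF \<phi>\<in>testing_procedures n. worst_risk f n \<Theta> \<phi>)"

definition Lam :: "(real \<Rightarrow> real \<Rightarrow> real) \<Rightarrow> nat \<Rightarrow> (nat \<Rightarrow> real) \<Rightarrow> real \<Rightarrow> real" where
  "Lam f k a t = (\<Sum>j=1..k. dist_fun f (a j) t) / real k"

definition assumption1_base ::
    "(real \<Rightarrow> real \<Rightarrow> real) \<Rightarrow> (nat \<Rightarrow> nat) \<Rightarrow> (nat \<Rightarrow> real) \<Rightarrow> (nat \<Rightarrow> real) \<Rightarrow> bool" where
  "assumption1_base f s astar \<delta> \<longleftrightarrow>
     (\<exists>L. \<forall>a. L-lipschitz_on UNIV (dist_fun f a)) \<and>
     (\<forall>n. 0 < astar n) \<and> filterlim astar at_top sequentially \<and>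
     (\<forall>n. 0 < \<delta> n) \<and> \<delta> \<longlonglongrightarrow> 0 \<and>
     filterlim (\<lambda>n. real n / real (s n) * surv_fun f 0 (astar n - \<delta> n)) at_top sequentially \<and>
     (\<lambda>n. real n / real (s n) * surv_fun f 0 (astar n)) \<longlonglongrightarrow> 0 \<and>
     continuous_on UNIV (f 0) \<and> (\<forall>x. 0 < f 0 x)"

text \<open>Increasing is understood in the weak sense in both alternatives.\<close>

definition assumption1_A :: "(real \<Rightarrow> real \<Rightarrow> real) \<Rightarrow> bool" where
  "assumption1_A f \<longleftrightarrow>
     (\<forall>a x. f (- a) (- x) = f a x) \<and>
     (\<forall>x. mono (\<lambda>a. surv_fun f a x)) \<and>
     (\<forall>a>0. mono (\<lambda>x. f a x / f 0 x))"

definition assumption1_B :: "(real \<Rightarrow> real \<Rightarrow> real) \<Rightarrow> bool" where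
  "assumption1_B f \<longleftrightarrow>
     (\<forall>a x. f a (- x) = f a x) \<and>
     (\<forall>x>0. mono_on {0<..} (\<lambda>a. surv_fun f a x)) \<and>
     (\<forall>a. a \<noteq> 0 \<longrightarrow> mono_on {0<..} (\<lambda>x. f a x / f 0 x))"

text \<open>
  Alternative B relates the members of the family with negative parameter only to the null
  density, whereas the signal class constrains only absolute values. If, for instance, the
  densities with parameter \<open>a > 0\<close> are centred Gaussian with scale \<open>1 + a\<close>, and those with
  parameter \<open>a < 0\<close> are centred Gaussian with scale \<open>1 + \<bar>a\<bar> / (1 + \<bar>a\<bar>)\<close>, then B holds but negative
  signals stay undetectable however large \<open>\<bar>a\<bar>\<close> is. The following condition (implied by
  \<open>f (- a) = f a\<close>) makes explicit that a negative signal is at least as strong as the positive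
  one of the same magnitude; under alternative A the first clause plays this role.
\<close>

definition negative_signals_as_strong :: "(real \<Rightarrow> real \<Rightarrow> real) \<Rightarrow> bool" where
  "negative_signals_as_strong f \<longleftrightarrow> (\<forall>a>0. \<forall>x>0. surv_fun f a x \<le> surv_fun f (- a) x)"

text \<open>
  Asymptotic attainment of the risk level \<open>r\<close> over the classes \<open>\<Theta>\<close> by procedures rejecting
  when \<open>\<bar>x i\<bar>\<close> exceeds a threshold. The threshold \<open>astar\<close> attains it along all indices with \<open>\<Lambda> n\<close>
  bounded away from 1. It cannot do so in general when \<open>\<Lambda> n\<close> tends to 1: in the Gaussian
  location model with about \<open>sqrt n\<close> signals of size \<open>1 / n\<close>, the test with threshold \<open>astar\<close> makes
  false discoveries and no true ones, and its risk tends to 2 although the minimax risk tends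
  to 1. Some sequence of thresholds attains the level without any restriction.
\<close>

definition threshold_attains ::
    "(real \<Rightarrow> real \<Rightarrow> real) \<Rightarrow> (nat \<Rightarrow> (nat \<Rightarrow> real) set) \<Rightarrow> (nat \<Rightarrow> real) \<Rightarrow> (nat \<Rightarrow> real) \<Rightarrow> (nat \<Rightarrow> real) \<Rightarrow> bool"
where
  "threshold_attains f \<Theta> astar \<Lambda> r \<longleftrightarrow>
     (\<forall>c<1. ((\<lambda>n. worst_risk f n (\<Theta> n) (threshold_procedure n (astar n)) - r n) \<longlongrightarrow> 0)
              (inf sequentially (principal {n. \<Lambda> n \<le> c}))) \<and>
     (\<exists>t. (\<lambda>n. worst_risk f n (\<Theta> n) (threshold_procedure n (t n)) - r n) \<longlonglongrightarrow> 0)"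

end

theory Submission
  imports Defs
begin

text \<open>
  Lower bound. Split the coordinates into \<open>s\<close> blocks and put one signal at a uniform position of each
  block. With at most \<open>M s\<close> rejections a false discovery costs at least \<open>1 / (M s)\<close>, and with more
  the false discovery proportion exceeds \<open>1 - 1 / M\<close>; so up to \<open>1 / M\<close> the risk dominates a
  classification loss that is additive over the blocks. Its Bayes rule rejects a coordinate only
  if its likelihood ratio exceeds \<open>1 / M\<close> times the sum of the other ratios in the block. Since the
  number of null observations beyond \<open>a* - \<delta>\<close> in a block tends to infinity and the likelihood ratio
  is monotone, a signal whose observation stays within \<open>a* - \<delta>\<close> is lost. By the Lipschitz property
  \<open>a* - \<delta>\<close> may be replaced by \<open>a*\<close>.

  Upper bound. The threshold \<open>a*\<close> makes \<open>o(s)\<close> false discoveries on average, and when \<open>\<Lambda>\<close> stays away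
  from 1 it makes at least a constant times \<open>s\<close> true ones with high probability.
\<close>

section \<open>The product model\<close>

text \<open>The false discovery proportion has a random denominator, so the risk is not a sum over
  coordinates and its Bayes rule is not explicit; truncation at \<open>M s\<close> rejections
  removes that denominator. \<open>M\<close> is a constant: it costs \<open>1 / M\<close> in the
  risk, and within a block it only has to be beaten by the number of null observations beyond the
  level, whose mean is at least of order \<open>(n / s) * surv_fun f 0 (a* - \<delta>)\<close> and
  diverges. At \<open>a*\<close> the same quantity tends to 0; hence the two bounds live at two
  levels, which only a Lipschitz correction brings together.

  The block prior has exactly \<open>s\<close> signals, unlike independent Bernoulli ones, and still
  has independent positions, so each block can be treated with the others frozen. The positions in a
  block are compared under one common law, in which that block is null, through a likelihood ratio
  in a single coordinate.

  Where \<open>\<Lambda>\<close> is near 1, true discoveries may be too few to outweigh even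
  \<open>o(s)\<close> false ones. A threshold that rejects almost nothing takes over there, since
  the target level is itself close to 1.\<close>

locale density_model =
  fixes f :: "real \<Rightarrow> real \<Rightarrow> real"
  assumes density_family: "density_family f"
begin

abbreviation obs :: "real \<Rightarrow> real measure" where
  "obs b \<equiv> density lborel (f b)"

lemma density_measurable [measurable]: "f b \<in> borel_measurable borel"
  and density_nonneg: "0 \<le> f b x"
  and density_integrable: "integrable lborel (f b)"
  and density_integral: "integral\<^sup>L lborel (f b) = 1"
  using density_family by (auto simp: density_family_def)

lemma prob_space_obs: "prob_space (obs b)"
proof
  have "(\<integral>\<^sup>+x. ennreal (f b x) \<partial>lborel) = 1"
    using nn_integral_eq_integral[OF density_integrable[of b]] density_integral[of b] density_nonneg
    by simp
  then show "emeasure (obs b) (space (obs b)) = 1"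
    by (simp add: emeasure_density)
qed

lemma measure_obs_UNIV [simp]: "measure (obs b) UNIV = 1"
  using prob_space.prob_space[OF prob_space_obs[of b]] by simp

lemma product_prob_space_obs: "product_prob_space (\<lambda>i. obs (\<theta> i))"
proof -
  interpret prob_space "obs (\<theta> i)" for i by (rule prob_space_obs)
  show ?thesis by unfold_locales
qed

lemma prob_space_law: "prob_space (law f n \<theta>)"
  unfolding law_def by (intro prob_space_PiM prob_space_obs)

lemma sets_law [measurable_cong]: "sets (law f n \<theta>) = sets (\<Pi>\<^sub>M i\<in>{1..n}. borel)"
  unfolding law_def by (intro sets_PiM_cong) auto

lemma space_law: "space (law f n \<theta>) = {1..n} \<rightarrow>\<^sub>E UNIV"
  unfolding law_def by (simp add: space_PiM)

lemma measurable_law_component: "i \<in> {1..n} \<Longrightarrow> (\<lambda>x. x i) \<in> borel_measurable (law f n \<theta>)"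
  by simp

lemma integrable_law_bounded:
  fixes g :: "(nat \<Rightarrow> real) \<Rightarrow> real"
  assumes "g \<in> borel_measurable (law f n \<theta>)" "\<And>x. x \<in> space (law f n \<theta>) \<Longrightarrow> \<bar>g x\<bar> \<le> C"
  shows "integrable (law f n \<theta>) g"
proof -
  interpret prob_space "law f n \<theta>" by (rule prob_space_law)
  show ?thesis
    using assms by (intro integrable_const_bound[where B=C]) auto
qed

lemma integral_law_component:
  fixes g :: "real \<Rightarrow> real"
  assumes [measurable]: "g \<in> borel_measurable borel" and "i \<in> {1..n}"
  shows "(\<integral>x. g (x i) \<partial>law f n \<theta>) = integral\<^sup>L (obs (\<theta> i)) g"
proof -
  interpret product_prob_space "\<lambda>i. obs (\<theta> i)" "{1..n}"
    by (rule product_prob_space_obs)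
  note [measurable] = measurable_law_component[OF assms(2)]
  have "distr (law f n \<theta>) (obs (\<theta> i)) (\<lambda>x. x i) = obs (\<theta> i)"
    unfolding law_def using assms(2) by (rule PiM_component)
  then have "integral\<^sup>L (obs (\<theta> i)) g
      = integral\<^sup>L (distr (law f n \<theta>) (obs (\<theta> i)) (\<lambda>x. x i)) g"
    by simp
  also have "\<dots> = (\<integral>x. g (x i) \<partial>law f n \<theta>)"
    by (rule integral_distr) auto
  finally show ?thesis by simp
qed

lemma integral_law_component_indicator:
  assumes "A \<in> sets borel" "i \<in> {1..n}"
  shows "(\<integral>x. indicator A (x i) \<partial>law f n \<theta>) = measure (obs (\<theta> i)) A"
  using integral_law_component[of "indicator A" i n \<theta>] assms by simp

text \<open>Both sides are product measures differing in the factor \<open>i\<close> alone, so it is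
  enough to compare rectangles, where the integral splits into one-dimensional ones. Positivity of
  \<open>f 0\<close> lets the quotient cancel. In this way signals at different positions are all
  expressed under one law.\<close>

lemma law_upd_density:
  assumes pos: "\<And>x. 0 < f 0 x" and i: "i \<in> {1..n}" and z: "\<theta> i = 0"
  shows "law f n (\<theta>(i := b)) = density (law f n \<theta>) (\<lambda>x. ennreal (f b (x i) / f 0 (x i)))"
proof -
  interpret P: product_prob_space "\<lambda>k. obs ((\<theta>(i := b)) k)" "{1..n}"
    by (rule product_prob_space_obs)
  interpret Q: product_prob_space "\<lambda>k. obs (\<theta> k)" "{1..n}"
    by (rule product_prob_space_obs)
  note [measurable] = measurable_law_component[OF i]
  have m [measurable]: "(\<lambda>x. ennreal (f b (x i) / f 0 (x i))) \<in> borel_measurable (law f n \<theta>)"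
    by measurable
  have "density (law f n \<theta>) (\<lambda>x. ennreal (f b (x i) / f 0 (x i)))
      = (\<Pi>\<^sub>M k\<in>{1..n}. obs ((\<theta>(i := b)) k))"
  proof (rule P.PiM_eqI)
    show "sets (density (law f n \<theta>) (\<lambda>x. ennreal (f b (x i) / f 0 (x i))))
        = sets (\<Pi>\<^sub>M k\<in>{1..n}. obs ((\<theta>(i := b)) k))"
      unfolding law_def by (simp cong: sets_PiM_cong)
    fix A assume A: "\<And>k. k \<in> {1..n} \<Longrightarrow> A k \<in> sets (obs ((\<theta>(i := b)) k))"
    then have A': "A k \<in> sets borel" if "k \<in> {1..n}" for k
      using that by force
    define g where "g k y = (if k = i then ennreal (f b y / f 0 y) else 1) * indicator (A k) y"
      for k and y :: real
    have S: "Pi\<^sub>E {1..n} A \<in> sets (law f n \<theta>)"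
      unfolding law_def using A' by (intro sets_PiM_I_finite) auto
    have pt: "ennreal (f b (x i) / f 0 (x i)) * indicator (Pi\<^sub>E {1..n} A) x
        = (\<Prod>k\<in>{1..n}. g k (x k))" if "x \<in> space (law f n \<theta>)" for x
    proof -
      have "(\<Prod>k\<in>{1..n}. g k (x k)) =
          (\<Prod>k\<in>{1..n}. if k = i then ennreal (f b (x i) / f 0 (x i)) else 1)
          * (\<Prod>k\<in>{1..n}. indicator (A k) (x k))"
        unfolding g_def prod.distrib by (intro arg_cong2[where f="(*)"] prod.cong) auto
      also have "(\<Prod>k\<in>{1..n}. if k = i then ennreal (f b (x i) / f 0 (x i)) else 1)
          = ennreal (f b (x i) / f 0 (x i))"
        using i by (subst prod.delta) auto
      also have "(\<Prod>k\<in>{1..n}. indicator (A k) (x k)) = (indicator (Pi\<^sub>E {1..n} A) x :: ennreal)"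
        using that by (auto simp: indicator_def space_law PiE_iff)
      finally show ?thesis by simp
    qed
    have gi: "(\<integral>\<^sup>+y. g k y \<partial>obs (\<theta> k)) = emeasure (obs ((\<theta>(i := b)) k)) (A k)"
      if k: "k \<in> {1..n}" for k
    proof (cases "k = i")
      case True
      have [measurable]: "A i \<in> sets borel" using A' i by auto
      have "(\<integral>\<^sup>+y. g i y \<partial>obs (\<theta> i))
          = (\<integral>\<^sup>+y. ennreal (f 0 y) * (ennreal (f b y / f 0 y) * indicator (A i) y) \<partial>lborel)"
        unfolding g_def z by (subst nn_integral_density) auto
      also have "\<dots> = (\<integral>\<^sup>+y. ennreal (f b y) * indicator (A i) y \<partial>lborel)"
      proof (intro nn_integral_cong)
        fix y
        have "f 0 y \<noteq> 0" using pos[of y] by simp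
        then have "ennreal (f 0 y) * ennreal (f b y / f 0 y) = ennreal (f b y)"
          using density_nonneg by (simp flip: ennreal_mult')
        then show "ennreal (f 0 y) * (ennreal (f b y / f 0 y) * indicator (A i) y)
            = ennreal (f b y) * indicator (A i) y"
          by (simp flip: mult.assoc)
      qed
      finally show ?thesis
        using True by (simp add: emeasure_density)
    next
      case False
      then show ?thesis using A'[OF k] by (simp add: g_def)
    qed
    have "emeasure (density (law f n \<theta>) (\<lambda>x. ennreal (f b (x i) / f 0 (x i)))) (Pi\<^sub>E {1..n} A)
        = (\<integral>\<^sup>+x. ennreal (f b (x i) / f 0 (x i)) * indicator (Pi\<^sub>E {1..n} A) x \<partial>law f n \<theta>)"
      using m S by (rule emeasure_density)
    also have "\<dots> = (\<integral>\<^sup>+x. (\<Prod>k\<in>{1..n}. g k (x k)) \<partial>law f n \<theta>)"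
      by (intro nn_integral_cong pt)
    also have "\<dots> = (\<Prod>k\<in>{1..n}. \<integral>\<^sup>+y. g k y \<partial>obs (\<theta> k))"
      unfolding law_def
    proof (rule Q.product_nn_integral_prod)
      fix k assume "k \<in> {1..n}"
      then have [measurable]: "A k \<in> sets borel" by (rule A')
      have "g k \<in> borel_measurable borel"
        unfolding g_def by measurable
      then show "g k \<in> borel_measurable (obs (\<theta> k))"
        by simp
    qed simp
    also have "\<dots> = (\<Prod>k\<in>{1..n}. emeasure (obs ((\<theta>(i := b)) k)) (A k))"
      by (intro prod.cong gi refl)
    finally show "emeasure (density (law f n \<theta>) (\<lambda>x. ennreal (f b (x i) / f 0 (x i)))) (Pi\<^sub>E {1..n} A)
        = (\<Prod>k\<in>{1..n}. emeasure (obs ((\<theta>(i := b)) k)) (A k))" .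
  qed simp
  then show ?thesis by (simp add: law_def)
qed

text \<open>The likelihood ratio may be unbounded, so integrability is not read off the integrand:
  it is inherited from the bounded \<open>g\<close> under the law that contains the signal.\<close>

lemma integral_law_upd:
  fixes g :: "(nat \<Rightarrow> real) \<Rightarrow> real"
  assumes pos: "\<And>x. 0 < f 0 x" and i: "i \<in> {1..n}" and z: "\<theta> i = 0"
    and g: "g \<in> borel_measurable (law f n \<theta>)"
    and bd: "\<And>x. x \<in> space (law f n \<theta>) \<Longrightarrow> \<bar>g x\<bar> \<le> C"
  shows "(\<integral>x. g x \<partial>law f n (\<theta>(i := b))) = (\<integral>x. f b (x i) / f 0 (x i) * g x \<partial>law f n \<theta>)" (is ?eq)
    and "integrable (law f n \<theta>) (\<lambda>x. f b (x i) / f 0 (x i) * g x)" (is ?int)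
proof -
  note [measurable] = measurable_law_component[OF i]
  have nn: "AE x in law f n \<theta>. 0 \<le> f b (x i) / f 0 (x i)"
    using density_nonneg less_imp_le[OF pos] by (intro AE_I2 divide_nonneg_nonneg) auto
  have m: "(\<lambda>x. f b (x i) / f 0 (x i)) \<in> borel_measurable (law f n \<theta>)"
    by measurable
  show ?eq
    unfolding law_upd_density[where b=b and \<theta>=\<theta>, OF pos i z] by (subst integral_density[OF g m nn]) simp
  have "sets (law f n (\<theta>(i := b))) = sets (law f n \<theta>)"
    by (simp add: sets_law)
  then have "g \<in> borel_measurable (law f n (\<theta>(i := b)))"
    using g measurable_cong_sets by blast
  then have "integrable (law f n (\<theta>(i := b))) g"
    using bd by (intro integrable_law_bounded) (auto simp: space_law)
  then show ?int
    unfolding law_upd_density[where b=b and \<theta>=\<theta>, OF pos i z] using integrable_density[OF g m nn] by simp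
qed

text \<open>A Chernoff bound: Markov's inequality for \<open>exp (- \<Sum>\<dots>)\<close>, with \<open>1 - 1 / e \<ge> 1 / 2\<close>.\<close>

lemma few_exceedances:
  assumes J: "J \<subseteq> {1..n}" and A: "\<And>k. k \<in> J \<Longrightarrow> A k \<in> sets borel"
  shows "(\<integral>x. of_bool ((\<Sum>k\<in>J. indicator (A k) (x k)) \<le> C) \<partial>law f n \<theta>)
    \<le> exp (C - (\<Sum>k\<in>J. measure (obs (\<theta> k)) (A k)) / 2)"
proof -
  interpret Q: product_prob_space "\<lambda>k. obs (\<theta> k)" "{1..n}"
    by (rule product_prob_space_obs)
  \<comment> \<open>The factor 1 outside \<open>J\<close> makes the exponential a product over all
    coordinates, the form to which the product integral applies.\<close>
  define h where "h k y = (if k \<in> J then exp (- indicator (A k) y) else (1::real))" for k y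
  have fJ: "finite J" using J finite_subset by blast
  \<comment> \<open>An indicator only takes the values 0 and 1, so its exponential is affine in it
    and the mean is explicit.\<close>
  have hA: "h k = (\<lambda>y. 1 - (1 - exp (- 1)) * indicator (A k) y)" if "k \<in> J" for k
    using that by (auto simp: h_def indicator_def fun_eq_iff)
  have h1: "h k = (\<lambda>y. 1)" if "k \<notin> J" for k
    using that by (auto simp: h_def)
  have [measurable]: "h k \<in> borel_measurable borel" for k
  proof (cases "k \<in> J")
    case True
    then have [measurable]: "A k \<in> sets borel" by (rule A)
    show ?thesis unfolding hA[OF True] by measurable
  next
    case False
    then show ?thesis by (simp add: h1)
  qed
  have prod_le: "(\<Prod>k\<in>{1..n}. h k (x k)) = exp (- (\<Sum>k\<in>J. indicator (A k) (x k)))" for x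
  proof -
    have "(\<Prod>k\<in>{1..n}. h k (x k)) = (\<Prod>k\<in>J. h k (x k))"
      using J by (intro prod.mono_neutral_right) (auto simp: h_def)
    also have "\<dots> = (\<Prod>k\<in>J. exp (- indicator (A k) (x k)))"
      by (intro prod.cong) (auto simp: h_def)
    also have "\<dots> = exp (\<Sum>k\<in>J. - indicator (A k) (x k))"
      using fJ by (rule exp_sum[symmetric])
    finally show ?thesis by (simp add: sum_negf)
  qed
  have hint: "integrable (obs (\<theta> k)) (h k)" for k
    by (rule finite_measure.integrable_const_bound[OF prob_space.finite_measure[OF prob_space_obs], where B=1]) (auto simp: h_def indicator_def)
  have e2: "1 / 2 \<le> 1 - exp (- 1 :: real)"
    using exp_ge_add_one_self[of "1::real"] by (simp add: exp_minus field_simps)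
  have hle: "integral\<^sup>L (obs (\<theta> k)) (h k) \<le> exp (- (measure (obs (\<theta> k)) (A k) / 2))"
    if k: "k \<in> J" for k
  proof -
    have [measurable]: "A k \<in> sets borel" using k by (rule A)
    have "integrable (obs (\<theta> k)) (indicat_real (A k))"
      by (rule finite_measure.integrable_const_bound[OF prob_space.finite_measure[OF prob_space_obs], where B=1]) auto
    then have "integral\<^sup>L (obs (\<theta> k)) (h k) = 1 - (1 - exp (- 1)) * measure (obs (\<theta> k)) (A k)"
      unfolding hA[OF k]
      by (subst Bochner_Integration.integral_diff) (auto simp: measure_obs_UNIV)
    also have "\<dots> \<le> 1 + (- (measure (obs (\<theta> k)) (A k) / 2))"
      using mult_right_mono[OF e2, of "measure (obs (\<theta> k)) (A k)"] by simp
    also have "\<dots> \<le> exp (- (measure (obs (\<theta> k)) (A k) / 2))"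
      by (rule exp_ge_add_one_self)
    finally show ?thesis .
  qed
  have indm: "(\<lambda>x. indicator (A k) (x k) :: real) \<in> borel_measurable (law f n \<theta>)" if "k \<in> J" for k
    using that J A[OF that] by (intro measurable_compose[OF measurable_law_component]) auto
  then have summ [measurable]:
    "(\<lambda>x. \<Sum>k\<in>J. indicator (A k) (x k) :: real) \<in> borel_measurable (law f n \<theta>)"
    by (intro borel_measurable_sum)
  have nn: "0 \<le> (\<Sum>k\<in>J. indicator (A k) (x k) :: real)" for x
    by (intro sum_nonneg) auto
  have "(\<integral>x. of_bool ((\<Sum>k\<in>J. indicator (A k) (x k)) \<le> C) \<partial>law f n \<theta>)
      \<le> (\<integral>x. exp C * (\<Prod>k\<in>{1..n}. h k (x k)) \<partial>law f n \<theta>)"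
    unfolding prod_le
  proof (rule integral_mono)
    show "integrable (law f n \<theta>) (\<lambda>x. of_bool ((\<Sum>k\<in>J. indicator (A k) (x k)) \<le> C) :: real)"
      by (rule integrable_law_bounded[where C=1]) auto
    show "integrable (law f n \<theta>) (\<lambda>x. exp C * exp (- (\<Sum>k\<in>J. indicator (A k) (x k))))"
      using nn by (intro integrable_law_bounded[where C="exp C"]) auto
    show "of_bool ((\<Sum>k\<in>J. indicator (A k) (x k)) \<le> C)
        \<le> exp C * exp (- (\<Sum>k\<in>J. indicator (A k) (x k)))" for x
      by (simp flip: exp_add)
  qed
  also have "\<dots> = exp C * (\<Prod>k\<in>{1..n}. integral\<^sup>L (obs (\<theta> k)) (h k))"
    unfolding law_def using hint by (simp add: Q.product_integral_prod)
  also have "(\<Prod>k\<in>{1..n}. integral\<^sup>L (obs (\<theta> k)) (h k)) = (\<Prod>k\<in>J. integral\<^sup>L (obs (\<theta> k)) (h k))"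
    using J by (intro prod.mono_neutral_right) (auto simp: h1 measure_obs_UNIV)
  also have "\<dots> \<le> (\<Prod>k\<in>J. exp (- (measure (obs (\<theta> k)) (A k) / 2)))"
    using hle by (intro prod_mono) (auto simp: h_def intro!: integral_nonneg)
  also have "\<dots> = exp (- ((\<Sum>k\<in>J. measure (obs (\<theta> k)) (A k)) / 2))"
    using fJ by (simp add: exp_sum[symmetric] sum_negf sum_divide_distrib)
  finally show ?thesis
    by (simp flip: exp_add)
qed

section \<open>Detection of one signal in a block\<close>

text \<open>Each term is the reward for rejecting the true position minus a price
  \<open>1 / M\<close> per other rejection in the block. Moved to the law with the block null and
  regrouped by coordinate, the sum gives \<open>\<psi> x i\<close> the weight
  \<open>lr (x i) - (\<Sum>k\<in>B - {i}. lr (x k)) / M\<close>. If \<open>x i\<close> lies outside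
  \<open>E\<close> and more than \<open>M\<close> other observations lie in \<open>T\<close>, each
  of these has a ratio of at least \<open>lr (x i)\<close>, and the weight is not positive. What
  remains is moved back to the signal law. \<open>E\<close> and \<open>T\<close> are kept apart so
  that points where ratios cannot be compared may be put into \<open>E\<close>.\<close>

lemma block_detection:
  fixes \<psi> :: "(nat \<Rightarrow> real) \<Rightarrow> nat \<Rightarrow> real"
  assumes pos: "\<And>x. 0 < f 0 x"
    and B: "B \<subseteq> {1..n}" and null: "\<And>k. k \<in> B \<Longrightarrow> \<theta> k = 0"
    and M: "0 < M"
    and E [measurable]: "E \<in> sets borel" and T [measurable]: "T \<in> sets borel"
    and mono: "\<And>x y. x \<notin> E \<Longrightarrow> y \<in> T \<Longrightarrow> f b x / f 0 x \<le> f b y / f 0 y"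
    and \<psi>_meas: "\<And>k. k \<in> B \<Longrightarrow> (\<lambda>x. \<psi> x k) \<in> borel_measurable (law f n \<theta>)"
    and \<psi>01: "\<And>x k. x \<in> space (law f n \<theta>) \<Longrightarrow> k \<in> B \<Longrightarrow> 0 \<le> \<psi> x k \<and> \<psi> x k \<le> 1"
  shows "(\<Sum>i\<in>B. \<integral>x. \<psi> x i - (\<Sum>k\<in>B - {i}. \<psi> x k) / M \<partial>law f n (\<theta>(i := b)))
    \<le> real (card B) * (measure (obs b) E + exp (M - real (card B - 1) * measure (obs 0) T / 2))"
proof -
  define lr where "lr y = f b y / f 0 y" for y
  define N where "N i x = (\<Sum>k\<in>B - {i}. indicat_real T (x k))" for i and x :: "nat \<Rightarrow> real"
  define g where "g i x = \<psi> x i - (\<Sum>k\<in>B - {i}. \<psi> x k) / M" for i x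
  \<comment> \<open>The only two ways in which rejecting \<open>i\<close> can pay: the observation
    falls into \<open>E\<close>, or too few others in the block fall into \<open>T\<close>.\<close>
  define h where "h i x = indicat_real E (x i) + of_bool (N i x \<le> M)" for i and x :: "nat \<Rightarrow> real"
  have fB: "finite B" using B finite_subset by blast
  have Bn: "i \<in> {1..n}" if "i \<in> B" for i using B that by auto
  have lr0: "0 \<le> lr y" for y
    using density_nonneg pos[of y] by (simp add: lr_def)
  have tm: "(\<lambda>x. indicat_real T (x k)) \<in> borel_measurable (law f n \<theta>')"
    and em: "(\<lambda>x. indicat_real E (x k)) \<in> borel_measurable (law f n \<theta>')" if "k \<in> B" for k \<theta>'
    using that E T by (auto intro!: measurable_compose[OF measurable_law_component[OF Bn]])
  have Nm [measurable]: "N i \<in> borel_measurable (law f n \<theta>')" for i \<theta>'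
    unfolding N_def by (intro borel_measurable_sum tm) auto
  have N0: "0 \<le> N i x" for i x
    unfolding N_def by (intro sum_nonneg) auto
  have gm: "g i \<in> borel_measurable (law f n \<theta>)" if "i \<in> B" for i
    unfolding g_def using \<psi>_meas that by (auto intro!: borel_measurable_sum borel_measurable_diff borel_measurable_divide)
  have hm: "h i \<in> borel_measurable (law f n \<theta>')" if "i \<in> B" for i \<theta>'
    unfolding h_def using em[OF that, measurable] by measurable
  have gb: "\<bar>g i x\<bar> \<le> 1 + real (card B) / M" if "i \<in> B" "x \<in> space (law f n \<theta>)" for i x
  proof -
    have "(\<Sum>k\<in>B - {i}. \<psi> x k) \<le> real (card (B - {i})) * 1"
      using \<psi>01[OF that(2)] by (intro sum_bounded_above) auto
    also have "\<dots> \<le> real (card B)"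
      using fB by (simp add: card_mono)
    finally have "(\<Sum>k\<in>B - {i}. \<psi> x k) / M \<le> real (card B) / M"
      using M by (simp add: divide_right_mono)
    moreover have "0 \<le> (\<Sum>k\<in>B - {i}. \<psi> x k) / M"
      using \<psi>01[OF that(2)] M by (intro divide_nonneg_pos sum_nonneg) auto
    moreover have "0 \<le> \<psi> x i \<and> \<psi> x i \<le> 1"
      using \<psi>01 that by auto
    ultimately show ?thesis unfolding g_def by linarith
  qed
  have hb: "\<bar>h i x\<bar> \<le> 2" for i x
    by (auto simp: h_def indicator_def)
  \<comment> \<open>The price for rejecting \<open>k\<close> when the signal sits at
    \<open>i\<close> is charged to \<open>k\<close> instead. Both arrangements are equal because the
    right-hand side of \<open>*\<close> is symmetric in \<open>p\<close> and
    \<open>q\<close>.\<close>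
  have swap: "(\<Sum>i\<in>B. lr (x i) * g i x)
      = (\<Sum>i\<in>B. \<psi> x i * (lr (x i) - (\<Sum>k\<in>B - {i}. lr (x k)) / M))" for x
  proof -
    have *: "(\<Sum>i\<in>B. p i * (q i - (\<Sum>k\<in>B - {i}. q k) / M))
        = (\<Sum>i\<in>B. p i * q i) * (1 + 1 / M) - (\<Sum>i\<in>B. p i) * (\<Sum>i\<in>B. q i) / M"
      for p q :: "nat \<Rightarrow> real"
    proof -
      have "p i * (q i - (\<Sum>k\<in>B - {i}. q k) / M)
          = p i * q i * (1 + 1 / M) - p i * ((\<Sum>k\<in>B. q k) / M)" if "i \<in> B" for i
        using fB that M by (subst sum_diff1) (auto simp: field_simps)
      then have "(\<Sum>i\<in>B. p i * (q i - (\<Sum>k\<in>B - {i}. q k) / M))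
          = (\<Sum>i\<in>B. p i * q i * (1 + 1 / M) - p i * ((\<Sum>k\<in>B. q k) / M))"
        by (intro sum.cong) auto
      then show ?thesis by (simp add: sum_subtractf flip: sum_distrib_right sum_divide_distrib)
    qed
    show ?thesis unfolding g_def * by (simp add: mult.commute)
  qed
  have pt: "\<psi> x i * (lr (x i) - (\<Sum>k\<in>B - {i}. lr (x k)) / M) \<le> lr (x i) * h i x"
    if i: "i \<in> B" and x: "x \<in> space (law f n \<theta>)" for i x
  proof (cases "x i \<in> E \<or> N i x \<le> M")
    case True
    have "0 \<le> (\<Sum>k\<in>B - {i}. lr (x k)) / M"
      using M lr0 by (intro divide_nonneg_pos sum_nonneg) auto
    then have "\<psi> x i * (lr (x i) - (\<Sum>k\<in>B - {i}. lr (x k)) / M) \<le> \<psi> x i * lr (x i)"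
      using \<psi>01[OF x i] by (intro mult_left_mono) auto
    also have "\<dots> \<le> 1 * lr (x i)"
      using \<psi>01[OF x i] lr0 by (intro mult_right_mono) auto
    also have "\<dots> \<le> lr (x i) * h i x"
      using True lr0[of "x i"] mult_left_mono[of 1 "h i x" "lr (x i)"] by (auto simp: h_def)
    finally show ?thesis .
  next
    case False
    have "lr (x i) * M \<le> lr (x i) * N i x"
      using False lr0 by (intro mult_left_mono) auto
    also have "\<dots> = (\<Sum>k\<in>B - {i}. lr (x i) * indicator T (x k))"
      by (simp add: N_def sum_distrib_left)
    also have "\<dots> \<le> (\<Sum>k\<in>B - {i}. lr (x k))"
      using mono False lr0 by (intro sum_mono) (auto simp: indicator_def lr_def)
    finally have "lr (x i) - (\<Sum>k\<in>B - {i}. lr (x k)) / M \<le> 0"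
      using M by (simp add: field_simps)
    then have "\<psi> x i * (lr (x i) - (\<Sum>k\<in>B - {i}. lr (x k)) / M) \<le> 0"
      using \<psi>01[OF x i] by (simp add: mult_nonneg_nonpos)
    also have "0 \<le> lr (x i) * h i x"
      using lr0 by (simp add: h_def)
    finally show ?thesis .
  qed
  have gI: "(\<integral>x. g i x \<partial>law f n (\<theta>(i := b))) = (\<integral>x. lr (x i) * g i x \<partial>law f n \<theta>)"
    "integrable (law f n \<theta>) (\<lambda>x. lr (x i) * g i x)" if i: "i \<in> B" for i
    using integral_law_upd[OF pos Bn[OF i] null[OF i] gm[OF i] gb[OF i], where b=b] by (auto simp: lr_def)
  have hI: "(\<integral>x. h i x \<partial>law f n (\<theta>(i := b))) = (\<integral>x. lr (x i) * h i x \<partial>law f n \<theta>)"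
    "integrable (law f n \<theta>) (\<lambda>x. lr (x i) * h i x)" if i: "i \<in> B" for i
    using integral_law_upd[OF pos Bn[OF i] null[OF i] hm[OF i, of \<theta>] hb[of i], where b=b] by (auto simp: lr_def)
  have hle: "(\<integral>x. h i x \<partial>law f n (\<theta>(i := b)))
      \<le> measure (obs b) E + exp (M - real (card B - 1) * measure (obs 0) T / 2)"
    if i: "i \<in> B" for i
  proof -
    let ?P = "law f n (\<theta>(i := b))"
    have "(\<integral>x. h i x \<partial>?P) = (\<integral>x. indicator E (x i) \<partial>?P) + (\<integral>x. of_bool (N i x \<le> M) \<partial>?P)"
      unfolding h_def using em[OF i]
      by (intro Bochner_Integration.integral_add integrable_law_bounded[where C=1]) auto
    also have "(\<integral>x. indicator E (x i) \<partial>?P) = measure (obs b) E"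
      using integral_law_component_indicator[OF E Bn[OF i], of "\<theta>(i := b)"] by simp
    also have "(\<integral>x. of_bool (N i x \<le> M) \<partial>?P)
        \<le> exp (M - (\<Sum>k\<in>B - {i}. measure (obs ((\<theta>(i := b)) k)) T) / 2)"
      unfolding N_def by (rule few_exceedances) (use B in auto)
    \<comment> \<open>A signal at \<open>i\<close> leaves the rest of the block null, so
      \<open>card B - 1\<close> coordinates count.\<close>
    also have "(\<Sum>k\<in>B - {i}. measure (obs ((\<theta>(i := b)) k)) T)
        = (\<Sum>k\<in>B - {i}. measure (obs 0) T)"
      using null by (intro sum.cong) auto
    also have "\<dots> = real (card B - 1) * measure (obs 0) T"
      using fB i by simp
    finally show ?thesis by (auto simp: fun_upd_def)
  qed
  have "(\<Sum>i\<in>B. \<integral>x. g i x \<partial>law f n (\<theta>(i := b))) = (\<Sum>i\<in>B. \<integral>x. lr (x i) * g i x \<partial>law f n \<theta>)"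
    by (intro sum.cong gI refl)
  also have "\<dots> = (\<integral>x. (\<Sum>i\<in>B. lr (x i) * g i x) \<partial>law f n \<theta>)"
    using gI(2) by (subst Bochner_Integration.integral_sum) auto
  also have "\<dots> \<le> (\<integral>x. (\<Sum>i\<in>B. lr (x i) * h i x) \<partial>law f n \<theta>)"
  proof (rule integral_mono)
    show "integrable (law f n \<theta>) (\<lambda>x. \<Sum>i\<in>B. lr (x i) * g i x)"
      "integrable (law f n \<theta>) (\<lambda>x. \<Sum>i\<in>B. lr (x i) * h i x)"
      using gI(2) hI(2) by auto
    show "(\<Sum>i\<in>B. lr (x i) * g i x) \<le> (\<Sum>i\<in>B. lr (x i) * h i x)"
      if "x \<in> space (law f n \<theta>)" for x
      unfolding swap using pt that by (intro sum_mono) auto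
  qed
  also have "\<dots> = (\<Sum>i\<in>B. \<integral>x. h i x \<partial>law f n (\<theta>(i := b)))"
    using hI by (subst Bochner_Integration.integral_sum) auto
  also have "\<dots> \<le> (\<Sum>i\<in>B. measure (obs b) E + exp (M - real (card B - 1) * measure (obs 0) T / 2))"
    by (intro sum_mono hle)
  finally show ?thesis unfolding g_def by simp
qed

end

section \<open>False discovery and non-discovery proportions\<close>

lemma testing_procedure_values:
  assumes "\<phi> \<in> testing_procedures n" "x \<in> {1..n} \<rightarrow>\<^sub>E UNIV" "i \<in> {1..n}"
  shows "\<phi> x i \<in> {0, 1}"
proof -
  have "\<phi> x \<in> space (\<Pi>\<^sub>M i\<in>{1..n}. count_space {0, 1})"
    using assms(1,2) unfolding testing_procedures_def
    by (intro measurable_space[of \<phi>]) (auto simp: space_PiM)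
  then show ?thesis using assms(3) by (auto simp: space_PiM PiE_iff)
qed

text \<open>A function of the realised decisions, so that inequalities between proportions can be
  proved for each outcome before integrating.\<close>

definition fdp :: "nat \<Rightarrow> (nat \<Rightarrow> real) \<Rightarrow> (nat \<Rightarrow> nat) \<Rightarrow> real" where
  "fdp n \<theta> d = (\<Sum>i=1..n. of_bool (\<theta> i = 0) * real (d i)) / max 1 (\<Sum>i=1..n. real (d i))"

definition fnp :: "nat \<Rightarrow> (nat \<Rightarrow> real) \<Rightarrow> (nat \<Rightarrow> nat) \<Rightarrow> real" where
  "fnp n \<theta> d = (\<Sum>i=1..n. of_bool (\<theta> i \<noteq> 0) * (1 - real (d i))) / max 1 (\<Sum>i=1..n. of_bool (\<theta> i \<noteq> 0))"

lemma ratio_max_1_le_1: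
  fixes u v :: real
  assumes "u \<le> v"
  shows "u / max 1 v \<le> 1"
  using assms by (subst divide_le_eq_1_pos) auto

lemma fdp_bounds: "0 \<le> fdp n \<theta> d" "fdp n \<theta> d \<le> 1"
proof -
  show "0 \<le> fdp n \<theta> d"
    unfolding fdp_def by (intro divide_nonneg_nonneg sum_nonneg) auto
  have "(\<Sum>i=1..n. of_bool (\<theta> i = 0) * real (d i)) \<le> (\<Sum>i=1..n. real (d i))"
    by (intro sum_mono) auto
  then show "fdp n \<theta> d \<le> 1"
    unfolding fdp_def by (rule ratio_max_1_le_1)
qed

lemma fnp_bounds:
  assumes "\<And>i. i \<in> {1..n} \<Longrightarrow> d i \<in> {0, 1}"
  shows "0 \<le> fnp n \<theta> d" "fnp n \<theta> d \<le> 1"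
proof -
  have d1: "real (d i) \<le> 1" if "i \<in> {1..n}" for i
    using assms[OF that] by auto
  show "0 \<le> fnp n \<theta> d"
    unfolding fnp_def using d1 by (intro divide_nonneg_nonneg sum_nonneg) auto
  have "(\<Sum>i=1..n. of_bool (\<theta> i \<noteq> 0) * (1 - real (d i))) \<le> (\<Sum>i=1..n. of_bool (\<theta> i \<noteq> 0))"
    by (intro sum_mono) (auto simp del: sum_mult_of_bool_eq)
  then show "fnp n \<theta> d \<le> 1"
    unfolding fnp_def by (rule ratio_max_1_le_1)
qed

lemma sum_of_bool_times:
  fixes g :: "'a \<Rightarrow> real"
  assumes "finite A"
  shows "(\<Sum>i\<in>A. of_bool (P i) * g i) = (\<Sum>i\<in>{i\<in>A. P i}. g i)"
  unfolding sum.inter_filter[OF assms] by (intro sum.cong) auto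

lemma fnp_eq:
  assumes "card {i\<in>{1..n}. \<theta> i \<noteq> 0} = s" "1 \<le> s"
  shows "fnp n \<theta> d = 1 - (\<Sum>i\<in>{i\<in>{1..n}. \<theta> i \<noteq> 0}. real (d i)) / real s"
proof -
  have "(\<Sum>i=1..n. of_bool (\<theta> i \<noteq> 0)) = real s"
    using sum_of_bool_times[of "{1..n}" "\<lambda>i. \<theta> i \<noteq> 0" "\<lambda>_. 1"] assms(1) by simp
  moreover have "(\<Sum>i=1..n. of_bool (\<theta> i \<noteq> 0) * (1 - real (d i)))
      = real s - (\<Sum>i\<in>{i\<in>{1..n}. \<theta> i \<noteq> 0}. real (d i))"
    using assms(1) by (subst sum_of_bool_times) (auto simp: sum_subtractf)
  ultimately show ?thesis
    using assms(2) by (simp add: fnp_def diff_divide_distrib)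
qed

text \<open>
  The ratio in the false discovery proportion is linearised: with at most \<open>M s\<close> rejections, a false
  discovery costs at least \<open>1 / (M s)\<close>; with more, all but a fraction \<open>1 / M\<close> of the rejections are
  false, so that rejecting nothing at all would be at most \<open>1 / M\<close> worse.
\<close>

lemma proportions_linear_lower:
  fixes d :: "nat \<Rightarrow> nat" and M :: real
  assumes d01: "\<And>i. i \<in> {1..n} \<Longrightarrow> d i \<in> {0, 1}"
    and card: "card {i\<in>{1..n}. \<theta> i \<noteq> 0} = s" and s: "1 \<le> s" and M: "1 \<le> M"
  defines "\<psi> \<equiv> \<lambda>i. real (d i) * of_bool ((\<Sum>k=1..n. real (d k)) \<le> M * real s)"
  shows "1 - 1 / M - ((\<Sum>i\<in>{i\<in>{1..n}. \<theta> i \<noteq> 0}. \<psi> i) - (\<Sum>i\<in>{i\<in>{1..n}. \<theta> i = 0}. \<psi> i) / M) / real s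
    \<le> fdp n \<theta> d + fnp n \<theta> d"
proof -
  define S where "S = (\<Sum>i\<in>{i\<in>{1..n}. \<theta> i \<noteq> 0}. real (d i))"
  define V where "V = (\<Sum>i\<in>{i\<in>{1..n}. \<theta> i = 0}. real (d i))"
  define R where "R = (\<Sum>k=1..n. real (d k))"
  have s0: "0 < real s" using s by simp
  have R: "R = S + V"
    unfolding R_def S_def V_def
    by (subst sum.union_disjoint[symmetric]) (auto intro!: sum.cong)
  have SV: "0 \<le> S" "0 \<le> V"
    unfolding S_def V_def by (auto intro: sum_nonneg)
  have "S \<le> (\<Sum>i\<in>{i\<in>{1..n}. \<theta> i \<noteq> 0}. 1)"
    unfolding S_def using d01 by (intro sum_mono) force
  then have Ss: "S \<le> real s" using card by simp
  have fn: "fnp n \<theta> d = 1 - S / real s"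
    unfolding S_def using card s by (rule fnp_eq)
  have fd: "fdp n \<theta> d = V / max 1 R"
    unfolding fdp_def V_def R_def by (subst sum_of_bool_times) auto
  show ?thesis
  proof (cases "R \<le> M * real s")
    case True
    then have \<psi>: "\<psi> = (\<lambda>i. real (d i))" by (simp add: \<psi>_def R_def)
    \<comment> \<open>As \<open>M * real s\<close> is at least 1, it dominates
      \<open>max 1 R\<close> and not only \<open>R\<close>.\<close>
    have "1 * 1 \<le> M * real s" using M s by (intro mult_mono) auto
    then have "V / (M * real s) \<le> V / max 1 R"
      using True SV by (intro divide_left_mono) auto
    moreover have "((\<Sum>i\<in>{i\<in>{1..n}. \<theta> i \<noteq> 0}. \<psi> i) - (\<Sum>i\<in>{i\<in>{1..n}. \<theta> i = 0}. \<psi> i) / M) / real s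
        = S / real s - V / (M * real s)"
      unfolding \<psi> S_def V_def by (simp add: diff_divide_distrib)
    moreover have "0 \<le> 1 / M" using M by simp
    ultimately show ?thesis unfolding fn fd by linarith
  next
    case False
    \<comment> \<open>Truncation leaves neither reward nor price here, so it remains to see that the
      false discovery proportion alone reaches \<open>1 - 1 / M\<close>.\<close>
    then have \<psi>: "\<psi> = (\<lambda>i. 0)" by (simp add: \<psi>_def R_def)
    have "1 * real s \<le> M * real s" using M by (intro mult_right_mono) auto
    then have R1: "real s < R" "1 < R" "M * real s < R" using False s by linarith+
    have "S / real s \<le> 1" using Ss s0 by simp
    moreover have "V / R = 1 - S / R" using R R1 by (simp add: field_simps)
    moreover have "S / R \<le> 1 / M"
    proof -
      have "S * M \<le> real s * M" using Ss M by (intro mult_right_mono) auto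
      also have "\<dots> \<le> R" using R1 by (simp add: mult.commute)
      finally show ?thesis using M R1 by (simp add: field_simps)
    qed
    ultimately show ?thesis unfolding fn fd \<psi> using R1 by simp
  qed
qed

section \<open>Measurability and integrability of the proportions, crude bounds on the risk\<close>

context density_model
begin

lemma testing_procedure_measurable:
  assumes "\<phi> \<in> testing_procedures n" "i \<in> {1..n}"
  shows "(\<lambda>x. real (\<phi> x i)) \<in> borel_measurable (law f n \<theta>)"
proof -
  have "\<phi> \<in> measurable (law f n \<theta>) (\<Pi>\<^sub>M i\<in>{1..n}. count_space {0, 1})"
    using assms(1) unfolding testing_procedures_def measurable_cong_sets[OF sets_law refl] .
  from measurable_compose[OF this measurable_component_singleton[OF assms(2)]]
  have "(\<lambda>x. \<phi> x i) \<in> measurable (law f n \<theta>) (count_space {0, 1})" .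
  then show ?thesis
    by (rule measurable_compose) simp
qed

lemma proportions_integrable:
  assumes "\<phi> \<in> testing_procedures n"
  shows "integrable (law f n \<theta>) (\<lambda>x. fdp n \<theta> (\<phi> x))" "integrable (law f n \<theta>) (\<lambda>x. fnp n \<theta> (\<phi> x))"
proof -
  note m [measurable] = testing_procedure_measurable[OF assms]
  have v: "\<phi> x i \<in> {0, 1}" if "x \<in> space (law f n \<theta>)" "i \<in> {1..n}" for x i
    using testing_procedure_values[OF assms _ that(2)] that(1) by (simp add: space_law)
  have R: "(\<lambda>x. \<Sum>i=1..n. real (\<phi> x i)) \<in> borel_measurable (law f n \<theta>)"
    and V: "(\<lambda>x. \<Sum>i=1..n. of_bool (\<theta> i = 0) * real (\<phi> x i)) \<in> borel_measurable (law f n \<theta>)"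
    and U: "(\<lambda>x. \<Sum>i=1..n. of_bool (\<theta> i \<noteq> 0) * (1 - real (\<phi> x i))) \<in> borel_measurable (law f n \<theta>)"
    by (intro borel_measurable_sum borel_measurable_times borel_measurable_diff
        borel_measurable_const m; assumption)+
  have "\<bar>fdp n \<theta> (\<phi> x)\<bar> \<le> 1" for x
    using fdp_bounds[of n \<theta> "\<phi> x"] by simp
  moreover have "(\<lambda>x. fdp n \<theta> (\<phi> x)) \<in> borel_measurable (law f n \<theta>)"
    unfolding fdp_def by (intro borel_measurable_divide borel_measurable_max borel_measurable_const R V)
  ultimately show "integrable (law f n \<theta>) (\<lambda>x. fdp n \<theta> (\<phi> x))"
    by (intro integrable_law_bounded)
  have "\<bar>fnp n \<theta> (\<phi> x)\<bar> \<le> 1" if "x \<in> space (law f n \<theta>)" for x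
    using fnp_bounds[of n "\<phi> x" \<theta>, OF v[OF that]] by simp
  moreover have "(\<lambda>x. fnp n \<theta> (\<phi> x)) \<in> borel_measurable (law f n \<theta>)"
    unfolding fnp_def by (intro borel_measurable_divide borel_measurable_max borel_measurable_const U)
  ultimately show "integrable (law f n \<theta>) (\<lambda>x. fnp n \<theta> (\<phi> x))"
    by (intro integrable_law_bounded)
qed

lemma FDR_eq: "FDR f n \<theta> \<phi> = (\<integral>x. fdp n \<theta> (\<phi> x) \<partial>law f n \<theta>)"
  and FNR_eq: "FNR f n \<theta> \<phi> = (\<integral>x. fnp n \<theta> (\<phi> x) \<partial>law f n \<theta>)"
  by (simp_all add: FDR_def FNR_def fdp_def fnp_def)

lemma multiple_risk_eq:
  assumes "\<phi> \<in> testing_procedures n"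
  shows "multiple_risk f n \<theta> \<phi> = (\<integral>x. fdp n \<theta> (\<phi> x) + fnp n \<theta> (\<phi> x) \<partial>law f n \<theta>)"
  using proportions_integrable[OF assms] by (simp add: multiple_risk_def FDR_eq FNR_eq)

lemma FNR_le_1:
  assumes "\<phi> \<in> testing_procedures n"
  shows "FNR f n \<theta> \<phi> \<le> 1"
proof -
  interpret prob_space "law f n \<theta>" by (rule prob_space_law)
  show ?thesis unfolding FNR_eq
  proof (rule integral_le_const[OF proportions_integrable(2)[OF assms]], rule AE_I2)
    fix x assume "x \<in> space (law f n \<theta>)"
    then show "fnp n \<theta> (\<phi> x) \<le> 1"
      using testing_procedure_values[OF assms] by (intro fnp_bounds) (simp add: space_law)
  qed
qed

lemma multiple_risk_le_2:
  assumes "\<phi> \<in> testing_procedures n"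
  shows "multiple_risk f n \<theta> \<phi> \<le> 2"
proof -
  interpret prob_space "law f n \<theta>" by (rule prob_space_law)
  have "FDR f n \<theta> \<phi> \<le> 1" unfolding FDR_eq
    by (rule integral_le_const[OF proportions_integrable(1)[OF assms]]) (auto intro: fdp_bounds)
  then show ?thesis using FNR_le_1[OF assms, of \<theta>] by (simp add: multiple_risk_def)
qed

lemma multiple_risk_le_worst_risk:
  assumes "\<phi> \<in> testing_procedures n" "\<theta> \<in> \<Theta>"
  shows "multiple_risk f n \<theta> \<phi> \<le> worst_risk f n \<Theta> \<phi>"
  unfolding worst_risk_def
  using multiple_risk_le_2[OF assms(1)] assms(2) by (intro cSUP_upper bdd_aboveI2[where M=2])

end

section \<open>The minimax lower bound\<close>

lemma card_pos_PiE: "finite I \<Longrightarrow> (\<And>i. i \<in> I \<Longrightarrow> finite (B i) \<and> B i \<noteq> {}) \<Longrightarrow> 0 < card (Pi\<^sub>E I B)"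
  by (simp add: card_PiE prod_pos card_gt_0_iff)

context density_model
begin

text \<open>
  Least favourable prior: one signal in each of \<open>s\<close> disjoint blocks of \<open>m\<close> coordinates, its
  position being uniform in the block and independent of the other blocks.
\<close>

lemma worst_risk_lower:
  fixes a :: "nat \<Rightarrow> real"
  assumes pos: "\<And>x. 0 < f 0 x"
    and s: "1 \<le> s" and m: "1 \<le> m" and smn: "s * m \<le> n"
    and a: "\<And>j. j \<in> {1..s} \<Longrightarrow> 0 < a j"
    and \<phi>: "\<phi> \<in> testing_procedures n"
    and M: "1 \<le> M"
    and E: "E \<in> sets borel" and T: "T \<in> sets borel"
    and mono: "\<And>j x y. j \<in> {1..s} \<Longrightarrow> x \<notin> E \<Longrightarrow> y \<in> T \<Longrightarrow> f (a j) x / f 0 x \<le> f (a j) y / f 0 y"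
  shows "1 - 1 / M - (\<Sum>j=1..s. measure (obs (a j)) E) / real s
      - exp (M - real (m - 1) * measure (obs 0) T / 2)
    \<le> worst_risk f n (signal_class n s a) \<phi>"
proof -
  define W where "W = worst_risk f n (signal_class n s a) \<phi>"
  \<comment> \<open>For \<open>j\<close> in \<open>{1..s}\<close> these are consecutive intervals of
    length \<open>m\<close> filling \<open>{1..s * m}\<close>; the coordinates beyond
    \<open>s * m\<close> are always null.\<close>
  define B where "B j = {(j - 1) * m<..j * m}" for j
  \<comment> \<open>With \<open>J = {1..s}\<close> this is the full signal, and with one index
    removed it is the background in which that block is null. For positions in different blocks at
    most one term of the sum is nonzero, so the sum stands in for a choice of index.\<close>
  define sig where "sig J \<sigma> = (\<lambda>i\<in>{1..n}. \<Sum>l\<in>J. if \<sigma> l = i then a l else 0)"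
    for J and \<sigma> :: "nat \<Rightarrow> nat"
  \<comment> \<open>The given decisions, replaced by no rejection at all once there are more than
    \<open>M s\<close> of them.\<close>
  define \<psi> where "\<psi> x k = real (\<phi> x k) * of_bool ((\<Sum>i=1..n. real (\<phi> x i)) \<le> M * real s)" for x k
  \<comment> \<open>Expected net gain in block \<open>j\<close>: detection of its signal minus the
    price of the false discoveries in that block.\<close>
  define H where "H j \<sigma> = (\<integral>x. \<psi> x (\<sigma> j) - (\<Sum>k\<in>B j - {\<sigma> j}. \<psi> x k) / M \<partial>law f n (sig {1..s} \<sigma>))"
    for j \<sigma>
  define \<epsilon> where "\<epsilon> = exp (M - real (m - 1) * measure (obs 0) T / 2)"
  define P where "P = Pi\<^sub>E {1..s} B"
  have s0: "0 < real s" using s by simp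
  have fB [simp]: "finite (B j)" for j by (simp add: B_def)
  have cB: "card (B j) = m" if "j \<in> {1..s}" for j
  proof -
    from that obtain j' where "j = Suc j'" by (cases j) auto
    then show ?thesis by (simp add: B_def)
  qed
  have Bn: "B j \<subseteq> {1..n}" if "j \<in> {1..s}" for j
  proof -
    have "j * m \<le> s * m" using that by simp
    then have "j * m \<le> n" using smn by linarith
    then show ?thesis by (auto simp: B_def)
  qed
  have disj: "B j \<inter> B l = {}" if "j < l" for j l
  proof -
    have "j * m \<le> (l - 1) * m" using that by (intro mult_right_mono) auto
    then show ?thesis by (auto simp: B_def)
  qed
  have Beq: "j = l" if "k \<in> B j" "k \<in> B l" for j l k
    using disj[of j l] disj[of l j] that by (cases j l rule: linorder_cases) auto
  have mem: "\<sigma> j \<in> B j" if "\<sigma> \<in> P" "j \<in> {1..s}" for \<sigma> j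
    using that unfolding P_def by (rule PiE_mem)
  have inj: "inj_on \<sigma> {1..s}" if \<sigma>: "\<sigma> \<in> P" for \<sigma>
  proof (rule inj_onI)
    fix j l assume "j \<in> {1..s}" "l \<in> {1..s}" "\<sigma> j = \<sigma> l"
    then show "j = l" using mem[OF \<sigma>, of j] mem[OF \<sigma>, of l] by (intro Beq[of "\<sigma> j"]) auto
  qed
  have sig_at: "sig {1..s} \<sigma> (\<sigma> j) = a j" if "\<sigma> \<in> P" "j \<in> {1..s}" for \<sigma> j
  proof -
    have "sig {1..s} \<sigma> (\<sigma> j) = (\<Sum>l\<in>{1..s}. if \<sigma> l = \<sigma> j then a l else 0)"
      using mem[OF that] Bn[OF that(2)] by (auto simp: sig_def)
    also have "\<dots> = (\<Sum>l\<in>{1..s}. if l = j then a l else 0)"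
      using inj_on_eq_iff[OF inj[OF that(1)] _ that(2)] by (intro sum.cong refl if_cong) blast+
    finally show ?thesis using that(2) by simp
  qed
  have sig_off: "sig J \<sigma> i = 0" if "i \<in> {1..n}" "i \<notin> \<sigma> ` J" for J \<sigma> i
    using that by (auto simp: sig_def intro!: sum.neutral)
  have supp: "{i\<in>{1..n}. sig {1..s} \<sigma> i \<noteq> 0} = \<sigma> ` {1..s}" if \<sigma>: "\<sigma> \<in> P" for \<sigma>
  proof (intro equalityI subsetI)
    fix i assume "i \<in> \<sigma> ` {1..s}"
    then obtain j where j: "j \<in> {1..s}" "i = \<sigma> j" by auto
    then show "i \<in> {i\<in>{1..n}. sig {1..s} \<sigma> i \<noteq> 0}"
      using sig_at[OF \<sigma> j(1)] a[OF j(1)] mem[OF \<sigma> j(1)] Bn[OF j(1)] by auto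
  qed (use sig_off[of _ \<sigma> "{1..s}"] in auto)
  have cs: "card (\<sigma> ` {1..s}) = s" if "\<sigma> \<in> P" for \<sigma>
    using card_image[OF inj[OF that]] by simp
  have sig_class: "sig {1..s} \<sigma> \<in> signal_class n s a" if \<sigma>: "\<sigma> \<in> P" for \<sigma>
  proof -
    have "sig {1..s} \<sigma> \<in> sparse_vectors n s"
      unfolding sparse_vectors_def using supp[OF \<sigma>] cs[OF \<sigma>] by (auto simp: sig_def)
    moreover have "\<sigma> ` {1..s} \<subseteq> {1..n}" using supp[OF \<sigma>] by blast
    moreover have "\<forall>j\<in>{1..s}. a j \<le> \<bar>sig {1..s} \<sigma> (\<sigma> j)\<bar>"
      using sig_at[OF \<sigma>] by force
    ultimately show ?thesis
      unfolding signal_class_def using inj[OF \<sigma>] by blast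
  qed
  have \<phi>01: "\<phi> x i \<in> {0, 1}" if "x \<in> space (law f n \<theta>)" "i \<in> {1..n}" for x i \<theta>
    using testing_procedure_values[OF \<phi> _ that(2)] that(1) by (simp add: space_law)
  note [measurable] = testing_procedure_measurable[OF \<phi>]
  have \<psi>m: "(\<lambda>x. \<psi> x k) \<in> borel_measurable (law f n \<theta>)" if "k \<in> {1..n}" for k \<theta>
  proof -
    have [measurable]: "(\<lambda>x. \<Sum>i=1..n. real (\<phi> x i)) \<in> borel_measurable (law f n \<theta>)"
      by (intro borel_measurable_sum testing_procedure_measurable[OF \<phi>])
    show ?thesis
      unfolding \<psi>_def using testing_procedure_measurable[OF \<phi> that, measurable] by measurable
  qed
  have \<psi>01: "0 \<le> \<psi> x k \<and> \<psi> x k \<le> 1" if "x \<in> space (law f n \<theta>)" "k \<in> {1..n}" for x k \<theta>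
    using \<phi>01[OF that] by (auto simp: \<psi>_def)
  have \<psi>i: "integrable (law f n \<theta>) (\<lambda>x. \<psi> x k)" if "k \<in> {1..n}" for k \<theta>
    using \<psi>m[OF that] \<psi>01[OF _ that] by (intro integrable_law_bounded[where C=1]) auto
  \<comment> \<open>This holds for every single configuration; the average over the prior enters
    only in \<open>avg\<close>.\<close>
  have risk: "1 - 1 / M - (\<Sum>j=1..s. H j \<sigma>) / real s \<le> W" if \<sigma>: "\<sigma> \<in> P" for \<sigma>
  proof -
    let ?\<theta> = "sig {1..s} \<sigma>"
    interpret prob_space "law f n ?\<theta>" by (rule prob_space_law)
    define G where "G x j = \<psi> x (\<sigma> j) - (\<Sum>k\<in>B j - {\<sigma> j}. \<psi> x k) / M" for x j
    have Gi: "integrable (law f n ?\<theta>) (\<lambda>x. G x j)" if j: "j \<in> {1..s}" for j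
      unfolding G_def using mem[OF \<sigma> j] Bn[OF j] \<psi>i by (intro Bochner_Integration.integrable_diff
        Bochner_Integration.integrable_sum integrable_divide) auto
    have "1 - 1 / M - (\<Sum>j=1..s. H j \<sigma>) / real s
        = (\<integral>x. 1 - 1 / M - (\<Sum>j=1..s. G x j) / real s \<partial>law f n ?\<theta>)"
    proof -
      have "integrable (law f n ?\<theta>) (\<lambda>x. (\<Sum>j=1..s. G x j) / real s)"
        using Gi by (intro integrable_divide Bochner_Integration.integrable_sum) auto
      then have "(\<integral>x. 1 - 1 / M - (\<Sum>j=1..s. G x j) / real s \<partial>law f n ?\<theta>)
          = (\<integral>x. 1 - 1 / M \<partial>law f n ?\<theta>) - (\<integral>x. (\<Sum>j=1..s. G x j) / real s \<partial>law f n ?\<theta>)"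
        by (intro Bochner_Integration.integral_diff integrable_const)
      also have "(\<integral>x. (\<Sum>j=1..s. G x j) / real s \<partial>law f n ?\<theta>)
          = (\<Sum>j=1..s. \<integral>x. G x j \<partial>law f n ?\<theta>) / real s"
        using Gi by (subst integral_divide_zero, subst Bochner_Integration.integral_sum) auto
      finally show ?thesis
        by (simp add: H_def G_def prob_space.prob_space[OF prob_space_law])
    qed
    also have "\<dots> \<le> multiple_risk f n ?\<theta> \<phi>"
      unfolding multiple_risk_eq[OF \<phi>]
    proof (rule integral_mono)
      show "integrable (law f n ?\<theta>) (\<lambda>x. 1 - 1 / M - (\<Sum>j=1..s. G x j) / real s)"
        using Gi by (intro Bochner_Integration.integrable_diff Bochner_Integration.integrable_sum
          integrable_divide integrable_const) auto
      show "integrable (law f n ?\<theta>) (\<lambda>x. fdp n ?\<theta> (\<phi> x) + fnp n ?\<theta> (\<phi> x))"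
        using proportions_integrable[OF \<phi>] by auto
      fix x assume x: "x \<in> space (law f n ?\<theta>)"
      \<comment> \<open>False discoveries outside the blocks are dropped, which can only lower the
        price and hence only weaken the lower bound.\<close>
      have "(\<Sum>j=1..s. \<Sum>k\<in>B j - {\<sigma> j}. \<psi> x k) = (\<Sum>k\<in>(\<Union>j\<in>{1..s}. B j - {\<sigma> j}). \<psi> x k)"
        using Beq by (subst sum.UNION_disjoint) auto
      also have "\<dots> \<le> (\<Sum>i\<in>{i\<in>{1..n}. ?\<theta> i = 0}. \<psi> x i)"
      proof (rule sum_mono2)
        show "(\<Union>j\<in>{1..s}. B j - {\<sigma> j}) \<subseteq> {i\<in>{1..n}. ?\<theta> i = 0}"
        proof safe
          fix j k assume j: "j \<in> {1..s}" and k: "k \<in> B j" "k \<noteq> \<sigma> j"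
          show kn: "k \<in> {1..n}" using Bn[OF j] k by auto
          have "k \<notin> \<sigma> ` {1..s}"
            using mem[OF \<sigma>] Beq k by blast
          then show "?\<theta> k = 0" using kn by (rule sig_off[rotated])
        qed
        show "0 \<le> \<psi> x b" if "b \<in> {i\<in>{1..n}. ?\<theta> i = 0} - (\<Union>j\<in>{1..s}. B j - {\<sigma> j})" for b
          using that \<psi>01[OF x, of b] by auto
      qed auto
      finally have "(\<Sum>j=1..s. G x j)
          \<ge> (\<Sum>i\<in>\<sigma> ` {1..s}. \<psi> x i) - (\<Sum>i\<in>{i\<in>{1..n}. ?\<theta> i = 0}. \<psi> x i) / M"
        using M unfolding G_def sum_subtractf sum_divide_distrib[symmetric]
        by (subst sum.reindex[OF inj[OF \<sigma>]]) (auto intro!: divide_right_mono)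
      then have le: "((\<Sum>i\<in>\<sigma> ` {1..s}. \<psi> x i) - (\<Sum>i\<in>{i\<in>{1..n}. ?\<theta> i = 0}. \<psi> x i) / M) / real s
          \<le> (\<Sum>j=1..s. G x j) / real s"
        by (intro divide_right_mono) auto
      have "1 - 1 / M - ((\<Sum>i\<in>\<sigma> ` {1..s}. \<psi> x i) - (\<Sum>i\<in>{i\<in>{1..n}. ?\<theta> i = 0}. \<psi> x i) / M) / real s
          \<le> fdp n ?\<theta> (\<phi> x) + fnp n ?\<theta> (\<phi> x)"
        unfolding \<psi>_def supp[OF \<sigma>, symmetric] using \<phi>01[OF x] cs[OF \<sigma>] supp[OF \<sigma>] s M
        by (intro proportions_linear_lower) auto
      with le show "1 - 1 / M - (\<Sum>j=1..s. G x j) / real s \<le> fdp n ?\<theta> (\<phi> x) + fnp n ?\<theta> (\<phi> x)"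
        by linarith
    qed
    also have "\<dots> \<le> W"
      unfolding W_def using \<phi> sig_class[OF \<sigma>] by (rule multiple_risk_le_worst_risk)
    finally show ?thesis .
  qed
  \<comment> \<open>With the positions in the other blocks frozen, the sum over the position in
    block \<open>j\<close> is the one in \<open>block_detection\<close>, and the bound does not
    depend on what was frozen.\<close>
  have avg: "(\<Sum>\<sigma>\<in>P. H j \<sigma>) \<le> real (card P) * (measure (obs (a j)) E + \<epsilon>)" if j: "j \<in> {1..s}" for j
  proof -
    let ?J = "{1..s} - {j}"
    have ins: "insert j ?J = {1..s}" using j by auto
    have Peq: "P = (\<lambda>(y, g). g(j := y)) ` (B j \<times> Pi\<^sub>E ?J B)"
      unfolding P_def by (subst PiE_insert_eq[of j ?J, unfolded ins]) simp
    have injc: "inj_on (\<lambda>(y, g). g(j := y)) (B j \<times> Pi\<^sub>E ?J B)"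
      by (rule inj_combinator) simp
    have cP: "card P = m * card (Pi\<^sub>E ?J B)"
      unfolding Peq card_image[OF injc] using cB[OF j] by (simp add: card_cartesian_product)
    have "(\<Sum>\<sigma>\<in>P. H j \<sigma>) = (\<Sum>(i, \<tau>)\<in>B j \<times> Pi\<^sub>E ?J B. H j (\<tau>(j := i)))"
      unfolding Peq sum.reindex[OF injc] by (intro sum.cong) auto
    also have "\<dots> = (\<Sum>\<tau>\<in>Pi\<^sub>E ?J B. \<Sum>i\<in>B j. H j (\<tau>(j := i)))"
      unfolding sum.cartesian_product[symmetric] by (rule sum.swap)
    also have "\<dots> \<le> (\<Sum>\<tau>\<in>Pi\<^sub>E ?J B. real m * (measure (obs (a j)) E + \<epsilon>))"
    proof (rule sum_mono)
      fix \<tau> assume \<tau>: "\<tau> \<in> Pi\<^sub>E ?J B"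
      have out: "k \<notin> \<tau> ` ?J" if "k \<in> B j" for k
        using \<tau> Beq[OF that] by (auto simp: PiE_iff)
      have upd: "sig {1..s} (\<tau>(j := i)) = (sig ?J \<tau>)(i := a j)" if i: "i \<in> B j" for i
      proof
        fix k
        have "(\<Sum>l\<in>{1..s}. if (\<tau>(j := i)) l = k then a l else 0)
            = (if i = k then a j else 0) + (\<Sum>l\<in>?J. if (\<tau>(j := i)) l = k then a l else 0)"
          using j by (subst sum.remove[of _ j]) auto
        also have "(\<Sum>l\<in>?J. if (\<tau>(j := i)) l = k then a l else 0) = (\<Sum>l\<in>?J. if \<tau> l = k then a l else 0)"
          by (intro sum.cong) auto
        finally have e: "(\<Sum>l\<in>{1..s}. if (\<tau>(j := i)) l = k then a l else 0)
            = (if i = k then a j else 0) + (\<Sum>l\<in>?J. if \<tau> l = k then a l else 0)" .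
        have z: "(\<Sum>l\<in>?J. if \<tau> l = i then a l else 0) = 0"
          using out[OF i] by (intro sum.neutral) auto
        show "sig {1..s} (\<tau>(j := i)) k = ((sig ?J \<tau>)(i := a j)) k"
          using e z Bn[OF j] i by (cases "k = i") (auto simp: sig_def)
      qed
      have "(\<Sum>i\<in>B j. H j (\<tau>(j := i)))
          = (\<Sum>i\<in>B j. \<integral>x. \<psi> x i - (\<Sum>k\<in>B j - {i}. \<psi> x k) / M \<partial>law f n ((sig ?J \<tau>)(i := a j)))"
        unfolding H_def using upd by (intro sum.cong) auto
      also have "\<dots> \<le> real (card (B j)) * (measure (obs (a j)) E
          + exp (M - real (card (B j) - 1) * measure (obs 0) T / 2))"
      proof (rule block_detection[OF pos Bn[OF j] _ _ E T mono[OF j]])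
        show "sig ?J \<tau> k = 0" if "k \<in> B j" for k
          using that Bn[OF j] out by (intro sig_off) auto
        show "0 < M" using M by simp
        show "(\<lambda>x. \<psi> x k) \<in> borel_measurable (law f n (sig ?J \<tau>))" if "k \<in> B j" for k
          using that Bn[OF j] by (intro \<psi>m) auto
        show "0 \<le> \<psi> x k \<and> \<psi> x k \<le> 1" if "x \<in> space (law f n (sig ?J \<tau>))" "k \<in> B j" for x k
          using that Bn[OF j] by (intro \<psi>01) auto
      qed
      finally show "(\<Sum>i\<in>B j. H j (\<tau>(j := i))) \<le> real m * (measure (obs (a j)) E + \<epsilon>)"
        using cB[OF j] by (simp add: \<epsilon>_def)
    qed
    also have "\<dots> = real (card P) * (measure (obs (a j)) E + \<epsilon>)"
      by (simp add: cP)
    finally show ?thesis .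
  qed
  have "B j \<noteq> {}" if "j \<in> {1..s}" for j
    using cB[OF that] m by auto
  then have Ppos: "0 < real (card P)"
    unfolding P_def of_nat_0_less_iff by (intro card_pos_PiE) auto
  \<comment> \<open>The worst case dominates the average over the prior; everything stays multiplied
    by \<open>card P\<close> until the end.\<close>
  have "real (card P) * (1 - 1 / M) - (\<Sum>j=1..s. \<Sum>\<sigma>\<in>P. H j \<sigma>) / real s
      = (\<Sum>\<sigma>\<in>P. 1 - 1 / M - (\<Sum>j=1..s. H j \<sigma>) / real s)"
    by (subst sum.swap) (simp add: sum_subtractf sum_divide_distrib[symmetric])
  also have "\<dots> \<le> real (card P) * W"
    using sum_mono[of P "\<lambda>\<sigma>. 1 - 1 / M - (\<Sum>j=1..s. H j \<sigma>) / real s" "\<lambda>_. W"] risk by simp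
  finally have 1: "real (card P) * (1 - 1 / M) - (\<Sum>j=1..s. \<Sum>\<sigma>\<in>P. H j \<sigma>) / real s \<le> real (card P) * W" .
  have "(\<Sum>j=1..s. \<Sum>\<sigma>\<in>P. H j \<sigma>) / real s
      \<le> (\<Sum>j=1..s. real (card P) * (measure (obs (a j)) E + \<epsilon>)) / real s"
    using avg by (intro divide_right_mono sum_mono) auto
  also have "\<dots> = real (card P) * ((\<Sum>j=1..s. measure (obs (a j)) E) / real s + \<epsilon>)"
    using s0 by (simp add: sum_distrib_left[symmetric] sum.distrib field_simps)
  finally have "real (card P) * (1 - 1 / M - (\<Sum>j=1..s. measure (obs (a j)) E) / real s - \<epsilon>)
      \<le> real (card P) * W"
    using 1 by (simp add: algebra_simps)
  then show ?thesis
    using Ppos unfolding W_def \<epsilon>_def by (simp del: of_nat_0_less_iff)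
qed

end

section \<open>Risk of thresholding procedures\<close>

lemma threshold_procedure_in_testing_procedures:
  "threshold_procedure n t \<in> testing_procedures n"
  unfolding testing_procedures_def threshold_procedure_def
proof (rule measurable_restrict)
  fix i assume "i \<in> {1..n}"
  then have "(\<lambda>x. x i) \<in> borel_measurable (\<Pi>\<^sub>M i\<in>{1..n}. (borel :: real measure))"
    by (rule measurable_component_singleton)
  moreover have "(\<lambda>y. if t < \<bar>y\<bar> then 1 else 0) \<in> measurable (borel :: real measure) (count_space {0, 1::nat})"
    by (intro measurable_If measurable_const) auto
  ultimately show "(\<lambda>x. if t < \<bar>x i\<bar> then 1 else 0)
      \<in> measurable (\<Pi>\<^sub>M i\<in>{1..n}. (borel :: real measure)) (count_space {0, 1::nat})"
    by (rule measurable_compose)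
qed

text \<open>The \<open>s\<close> distinct positions carry nonzero entries because every
  \<open>a j\<close> is positive, and sparsity leaves room for no others. The support is therefore
  the image of the positions, and a bound for each signal can be summed by reindexing.\<close>

lemma signal_class_support:
  fixes h :: "real \<Rightarrow> real"
  assumes \<theta>: "\<theta> \<in> signal_class n s a" and a: "\<And>j. j \<in> {1..s} \<Longrightarrow> 0 < a j"
    and g: "\<And>j b. j \<in> {1..s} \<Longrightarrow> a j \<le> \<bar>b\<bar> \<Longrightarrow> g j \<le> h b"
  shows "card {i\<in>{1..n}. \<theta> i \<noteq> 0} = s"
    and "(\<Sum>j=1..s. g j) \<le> (\<Sum>i\<in>{i\<in>{1..n}. \<theta> i \<noteq> 0}. h (\<theta> i))"
proof -
  from \<theta> obtain i where i: "inj_on i {1..s}" "i ` {1..s} \<subseteq> {1..n}"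
      "\<And>j. j \<in> {1..s} \<Longrightarrow> a j \<le> \<bar>\<theta> (i j)\<bar>"
    and c: "card {i\<in>{1..n}. \<theta> i \<noteq> 0} \<le> s"
    by (auto simp: signal_class_def sparse_vectors_def)
  have "i ` {1..s} \<subseteq> {i\<in>{1..n}. \<theta> i \<noteq> 0}"
    using i(2,3) a by fastforce
  moreover have "card (i ` {1..s}) = s"
    using card_image[OF i(1)] by simp
  ultimately have eq: "i ` {1..s} = {i\<in>{1..n}. \<theta> i \<noteq> 0}"
    using c by (intro card_seteq) auto
  show "card {i\<in>{1..n}. \<theta> i \<noteq> 0} = s"
    using eq \<open>card (i ` {1..s}) = s\<close> by simp
  show "(\<Sum>j=1..s. g j) \<le> (\<Sum>i\<in>{i\<in>{1..n}. \<theta> i \<noteq> 0}. h (\<theta> i))"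
    unfolding eq[symmetric] sum.reindex[OF i(1)] using g i(3) by (intro sum_mono) auto
qed

text \<open>A real-valued supremum over an empty class carries no information, so this is needed
  before \<open>worst_risk\<close> can be bounded above.\<close>

lemma signal_class_nonempty:
  assumes "s \<le> n" "\<And>j. j \<in> {1..s} \<Longrightarrow> 0 < a j"
  shows "signal_class n s a \<noteq> {}"
proof -
  define \<theta> where "\<theta> = (\<lambda>i\<in>{1..n}. if i \<le> s then a i else 0)"
  have "{i\<in>{1..n}. \<theta> i \<noteq> 0} \<subseteq> {1..s}"
    by (auto simp: \<theta>_def)
  then have "card {i\<in>{1..n}. \<theta> i \<noteq> 0} \<le> card {1..s}"
    by (intro card_mono) auto
  then have "\<theta> \<in> sparse_vectors n s"
    by (auto simp: sparse_vectors_def \<theta>_def)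
  moreover have "inj_on (\<lambda>i. i) {1..s} \<and> (\<lambda>i. i) ` {1..s} \<subseteq> {1..n} \<and> (\<forall>j\<in>{1..s}. a j \<le> \<bar>\<theta> j\<bar>)"
    using assms(1) by (auto simp: \<theta>_def)
  ultimately have "\<theta> \<in> signal_class n s a"
    unfolding signal_class_def by blast
  then show ?thesis by auto
qed

context density_model
begin

lemma multiple_risk_nonneg:
  assumes "\<phi> \<in> testing_procedures n"
  shows "0 \<le> multiple_risk f n \<theta> \<phi>"
  unfolding multiple_risk_eq[OF assms]
proof (rule integral_nonneg_AE, rule AE_I2)
  fix x assume "x \<in> space (law f n \<theta>)"
  then have "0 \<le> fnp n \<theta> (\<phi> x)"
    using testing_procedure_values[OF assms] by (intro fnp_bounds) (simp add: space_law)
  then show "0 \<le> fdp n \<theta> (\<phi> x) + fnp n \<theta> (\<phi> x)"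
    using fdp_bounds(1)[of n \<theta> "\<phi> x"] by linarith
qed

text \<open>Any one parameter of the class bounds every worst risk below by 0, which makes the
  infimum genuine.\<close>

lemma minimax_risk_le_worst_risk:
  assumes "\<phi> \<in> testing_procedures n" "\<Theta> \<noteq> {}"
  shows "minimax_risk f n \<Theta> \<le> worst_risk f n \<Theta> \<phi>"
  unfolding minimax_risk_def
proof (rule cINF_lower[OF _ assms(1)], rule bdd_belowI2[where m=0])
  fix \<phi> assume \<phi>: "\<phi> \<in> testing_procedures n"
  from assms(2) obtain \<theta> where \<theta>: "\<theta> \<in> \<Theta>" by auto
  show "0 \<le> worst_risk f n \<Theta> \<phi>"
    using multiple_risk_nonneg[OF \<phi>] multiple_risk_le_worst_risk[OF \<phi> \<theta>] by (rule order_trans)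
qed

section \<open>Tail probabilities of a single observation\<close>

lemma measure_obs:
  assumes [measurable]: "A \<in> sets borel"
  shows "measure (obs b) A = (\<integral>t. f b t * indicator A t \<partial>lborel)"
proof -
  have "measure (obs b) A = integral\<^sup>L (obs b) (indicator A)"
    by simp
  also have "\<dots> = (\<integral>t. f b t *\<^sub>R indicator A t \<partial>lborel)"
    using density_nonneg by (intro integral_density) auto
  finally show ?thesis by simp
qed

lemma measure_obs_greaterThan: "measure (obs b) {x<..} = surv_fun f b x"
proof -
  interpret prob_space "obs b" by (rule prob_space_obs)
  have "measure (obs b) {..x} = dist_fun f b x"
    by (simp add: measure_obs dist_fun_def set_lebesgue_integral_def mult.commute)
  moreover have "{x<..} = space (obs b) - {..x}"
    by auto
  ultimately show ?thesis
    by (simp only: prob_compl[of "{..x}"] surv_fun_def sets_density sets_lborel)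
       (simp add: surv_fun_def prob_compl[of "{..x}", simplified])
qed

lemma surv_fun_bounds: "0 \<le> surv_fun f b x" "surv_fun f b x \<le> 1"
  unfolding measure_obs_greaterThan[symmetric]
  using prob_space.prob_le_1[OF prob_space_obs[of b]] by auto

text \<open>Substitution of \<open>- t\<close> for \<open>t\<close>. The parameters \<open>b\<close>
  and \<open>b'\<close> may differ because reflection flips the sign of the parameter under one
  alternative and keeps it under the other.\<close>

lemma measure_obs_reflect:
  assumes "\<And>t. f b (- t) = f b' t"
  shows "measure (obs b) {..<- x} = surv_fun f b' x"
proof -
  have "measure (obs b) {..<- x} = (\<integral>t. f b (- t) * indicator {..<- x} (- t) \<partial>lborel)"
    using lborel_integral_real_affine[of "-1" "\<lambda>t. f b t * indicator {..<- x} t" 0]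
    by (simp add: measure_obs)
  also have "\<dots> = (\<integral>t. f b' t * indicator {x<..} t \<partial>lborel)"
    by (intro Bochner_Integration.integral_cong) (auto simp: assms indicator_def)
  finally show ?thesis
    by (simp add: measure_obs flip: measure_obs_greaterThan)
qed

lemma measure_obs_two_sided:
  assumes "0 \<le> t"
  shows "measure (obs b) {x. t < \<bar>x\<bar>} = surv_fun f b t + measure (obs b) {..<- t}"
proof -
  interpret prob_space "obs b" by (rule prob_space_obs)
  have "{x. t < \<bar>x\<bar>} = {t<..} \<union> {..<- t}"
    by auto
  moreover have "{t<..} \<inter> {..<- t} = {}"
    using assms by auto
  ultimately show ?thesis
    by (simp add: finite_measure_Union measure_obs_greaterThan)
qed

text \<open>A law with a density ignores single points. This absorbs the origin, about which
  monotonicity on the positive half-line says nothing.\<close>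

lemma measure_obs_insert:
  assumes "A \<in> sets borel"
  shows "measure (obs b) (insert x A) = measure (obs b) A"
proof -
  have "AE t in lborel. t \<noteq> x"
    using AE_lborel_singleton[of x] by simp
  then have "(\<integral>t. f b t * indicator (insert x A) t \<partial>lborel) = (\<integral>t. f b t * indicator A t \<partial>lborel)"
    using assms by (intro integral_cong_AE) (auto simp: indicator_def)
  then show ?thesis
    using assms by (simp add: measure_obs)
qed

text \<open>Here \<open>g j\<close> is a guaranteed detection probability for any signal of size at
  least \<open>a j\<close>. The bound \<open>1 + real n * p\<close> gives up on all signals and
  charges each false discovery fully. The other bound splits on whether more than
  \<open>\<eta> * real s\<close> true discoveries occur: if so, the denominator exceeds
  \<open>\<eta> * real s\<close>; otherwise the proportion is bounded by 1 on an event controlled by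
  \<open>few_exceedances\<close>.\<close>

lemma threshold_risk_upper:
  assumes s: "1 \<le> s" "s \<le> n" and a: "\<And>j. j \<in> {1..s} \<Longrightarrow> 0 < a j"
    and g: "\<And>j b. j \<in> {1..s} \<Longrightarrow> a j \<le> \<bar>b\<bar> \<Longrightarrow> g j \<le> measure (obs b) {x. t < \<bar>x\<bar>}"
    and \<eta>: "0 < \<eta>"
  defines "p \<equiv> measure (obs 0) {x. t < \<bar>x\<bar>}"
    and "w \<equiv> worst_risk f n (signal_class n s a) (threshold_procedure n t)"
  shows "w \<le> 1 + real n * p"
    and "w \<le> real n * p / (\<eta> * real s) + exp (\<eta> * real s - (\<Sum>j=1..s. g j) / 2)
      + (1 - (\<Sum>j=1..s. g j) / real s)"
proof -
  define T where "T = {x::real. t < \<bar>x\<bar>}"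
  define \<phi> where "\<phi> = threshold_procedure n t"
  have T [measurable]: "T \<in> sets borel" unfolding T_def by measurable
  have \<phi>: "\<phi> \<in> testing_procedures n"
    unfolding \<phi>_def by (rule threshold_procedure_in_testing_procedures)
  have \<phi>i: "real (\<phi> x i) = indicator T (x i)" if "i \<in> {1..n}" for x i
    using that by (simp add: \<phi>_def threshold_procedure_def T_def)
  have s0: "0 < real s" using s by simp
  have ind: "integrable (law f n \<theta>) (\<lambda>x. indicat_real T (x i))" if "i \<in> {1..n}" for i \<theta>
    using that by (intro integrable_law_bounded[where C=1]
        measurable_compose[OF measurable_law_component]) auto
  have ne: "signal_class n s a \<noteq> {}"
    using signal_class_nonempty[OF s(2) a] .
  have FDR1: "FDR f n \<theta> \<phi> \<le> real n * p"
    and FDR2: "FDR f n \<theta> \<phi> \<le> real n * p / (\<eta> * real s) + exp (\<eta> * real s - (\<Sum>j=1..s. g j) / 2)"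
    and FNR: "FNR f n \<theta> \<phi> \<le> 1 - (\<Sum>j=1..s. g j) / real s"
    if \<theta>: "\<theta> \<in> signal_class n s a" for \<theta>
  proof -
    interpret prob_space "law f n \<theta>" by (rule prob_space_law)
    define I where "I = {i\<in>{1..n}. \<theta> i \<noteq> 0}"
    define J where "J = {i\<in>{1..n}. \<theta> i = 0}"
    define S where "S x = (\<Sum>i\<in>I. indicat_real T (x i))" for x :: "nat \<Rightarrow> real"
    define V where "V x = (\<Sum>i\<in>J. indicat_real T (x i))" for x :: "nat \<Rightarrow> real"
    have IJ: "I \<subseteq> {1..n}" "J \<subseteq> {1..n}" "I \<union> J = {1..n}" "I \<inter> J = {}" "finite I" "finite J"
      by (auto simp: I_def J_def)
    have cI: "card I = s"
      unfolding I_def using signal_class_support(1)[OF \<theta> a g] .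
    have q: "(\<Sum>j=1..s. g j) \<le> (\<Sum>i\<in>I. measure (obs (\<theta> i)) T)"
      unfolding I_def T_def using signal_class_support(2)[OF \<theta> a g] .
    have SV: "0 \<le> S x" "0 \<le> V x" for x
      unfolding S_def V_def by (auto intro: sum_nonneg)
    have Si: "integrable (law f n \<theta>) S" and Vi: "integrable (law f n \<theta>) V"
      unfolding S_def V_def using IJ by (auto intro!: Bochner_Integration.integrable_sum ind)
    have sumR: "(\<Sum>i=1..n. real (\<phi> x i)) = S x + V x" for x
    proof -
      have "(\<Sum>i=1..n. real (\<phi> x i)) = (\<Sum>i\<in>I \<union> J. indicat_real T (x i))"
        unfolding IJ(3) by (intro sum.cong refl \<phi>i)
      also have "\<dots> = S x + V x"
        unfolding S_def V_def by (rule sum.union_disjoint[OF IJ(5,6,4)])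
      finally show ?thesis .
    qed
    have fdp: "fdp n \<theta> (\<phi> x) = V x / max 1 (S x + V x)" for x
    proof -
      have "(\<Sum>i=1..n. of_bool (\<theta> i = 0) * real (\<phi> x i)) = (\<Sum>i\<in>J. real (\<phi> x i))"
        unfolding J_def by (rule sum_of_bool_times) simp
      also have "\<dots> = V x"
        unfolding V_def using IJ by (intro sum.cong refl \<phi>i) auto
      finally show ?thesis unfolding fdp_def sumR by (rule arg_cong)
    qed
    have EV: "(\<integral>x. V x \<partial>law f n \<theta>) \<le> real n * p"
    proof -
      have "(\<integral>x. V x \<partial>law f n \<theta>) = (\<Sum>i\<in>J. \<integral>x. indicator T (x i) \<partial>law f n \<theta>)"
        unfolding V_def using IJ ind by (intro Bochner_Integration.integral_sum) auto
      also have "\<dots> = (\<Sum>i\<in>J. p)"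
        unfolding p_def T_def[symmetric] using IJ
        by (intro sum.cong refl) (auto simp: integral_law_component_indicator[OF T] J_def)
      also have "\<dots> \<le> real n * p"
        using card_mono[OF _ IJ(2)] by (auto simp: p_def intro!: mult_right_mono)
      finally show ?thesis .
    qed
    have "FDR f n \<theta> \<phi> \<le> (\<integral>x. V x \<partial>law f n \<theta>)"
      unfolding FDR_eq
    proof (rule integral_mono[OF proportions_integrable(1)[OF \<phi>] Vi])
      show "fdp n \<theta> (\<phi> x) \<le> V x" for x
        unfolding fdp using divide_left_mono[of 1 "max 1 (S x + V x)" "V x"] SV[of x] by simp
    qed
    with EV show "FDR f n \<theta> \<phi> \<le> real n * p" by simp
    have [measurable]: "S \<in> borel_measurable (law f n \<theta>)"
      using Si by auto
    have bi: "integrable (law f n \<theta>) (\<lambda>x. of_bool (S x \<le> \<eta> * real s) :: real)"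
      by (rule integrable_law_bounded[where C=1]) auto
    have "FDR f n \<theta> \<phi> \<le> (\<integral>x. V x / (\<eta> * real s) + of_bool (S x \<le> \<eta> * real s) \<partial>law f n \<theta>)"
      unfolding FDR_eq
    proof (rule integral_mono[OF proportions_integrable(1)[OF \<phi>]])
      show "integrable (law f n \<theta>) (\<lambda>x. V x / (\<eta> * real s) + of_bool (S x \<le> \<eta> * real s))"
        using Vi bi by (intro Bochner_Integration.integrable_add integrable_divide)
      fix x
      show "fdp n \<theta> (\<phi> x) \<le> V x / (\<eta> * real s) + of_bool (S x \<le> \<eta> * real s)"
      proof (cases "S x \<le> \<eta> * real s")
        case True
        have "0 \<le> V x / (\<eta> * real s)" using SV[of x] \<eta> s0 by simp
        with True show ?thesis using fdp_bounds(2)[of n \<theta> "\<phi> x"] by simp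
      next
        case False
        have "V x / max 1 (S x + V x) \<le> V x / (\<eta> * real s)"
          using SV[of x] False \<eta> s0 by (intro divide_left_mono mult_pos_pos) auto
        then show ?thesis using False by (simp add: fdp)
      qed
    qed
    also have "\<dots> = (\<integral>x. V x \<partial>law f n \<theta>) / (\<eta> * real s)
        + (\<integral>x. of_bool (S x \<le> \<eta> * real s) \<partial>law f n \<theta>)"
      using Vi bi by (subst Bochner_Integration.integral_add) auto
    also have "(\<integral>x. V x \<partial>law f n \<theta>) / (\<eta> * real s) \<le> real n * p / (\<eta> * real s)"
      using EV \<eta> s0 by (intro divide_right_mono) auto
    also have "(\<integral>x. of_bool (S x \<le> \<eta> * real s) \<partial>law f n \<theta>)
        \<le> exp (\<eta> * real s - (\<Sum>i\<in>I. measure (obs (\<theta> i)) T) / 2)"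
      unfolding S_def by (rule few_exceedances) (use IJ in auto)
    also have "\<dots> \<le> exp (\<eta> * real s - (\<Sum>j=1..s. g j) / 2)"
      using q by simp
    finally show "FDR f n \<theta> \<phi> \<le> real n * p / (\<eta> * real s) + exp (\<eta> * real s - (\<Sum>j=1..s. g j) / 2)"
      by simp
    have "FNR f n \<theta> \<phi> = (\<integral>x. 1 - S x / real s \<partial>law f n \<theta>)"
      unfolding FNR_eq
    proof (intro Bochner_Integration.integral_cong refl)
      fix x
      have "(\<Sum>i\<in>I. real (\<phi> x i)) = S x"
        unfolding S_def using IJ by (intro sum.cong refl \<phi>i) auto
      then show "fnp n \<theta> (\<phi> x) = 1 - S x / real s"
        using fnp_eq[of n \<theta> s "\<phi> x"] cI s(1) by (simp add: I_def)
    qed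
    also have "\<dots> = 1 - (\<integral>x. S x \<partial>law f n \<theta>) / real s"
      using Si by (simp add: prob_space)
    also have "(\<integral>x. S x \<partial>law f n \<theta>) = (\<Sum>i\<in>I. \<integral>x. indicator T (x i) \<partial>law f n \<theta>)"
      unfolding S_def using IJ ind by (intro Bochner_Integration.integral_sum) auto
    also have "\<dots> = (\<Sum>i\<in>I. measure (obs (\<theta> i)) T)"
      using IJ by (intro sum.cong refl integral_law_component_indicator T) auto
    also have "1 - \<dots> / real s \<le> 1 - (\<Sum>j=1..s. g j) / real s"
      using q s0 by (simp add: divide_right_mono)
    finally show "FNR f n \<theta> \<phi> \<le> 1 - (\<Sum>j=1..s. g j) / real s" .
  qed
  show "w \<le> 1 + real n * p"
    unfolding w_def worst_risk_def \<phi>_def[symmetric]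
  proof (rule cSUP_least[OF ne])
    show "multiple_risk f n \<theta> \<phi> \<le> 1 + real n * p" if "\<theta> \<in> signal_class n s a" for \<theta>
      using FDR1[OF that] FNR_le_1[OF \<phi>, of \<theta>] by (simp add: multiple_risk_def)
  qed
  show "w \<le> real n * p / (\<eta> * real s) + exp (\<eta> * real s - (\<Sum>j=1..s. g j) / 2)
      + (1 - (\<Sum>j=1..s. g j) / real s)"
    unfolding w_def worst_risk_def \<phi>_def[symmetric]
  proof (rule cSUP_least[OF ne])
    show "multiple_risk f n \<theta> \<phi> \<le> real n * p / (\<eta> * real s)
        + exp (\<eta> * real s - (\<Sum>j=1..s. g j) / 2) + (1 - (\<Sum>j=1..s. g j) / real s)"
      if "\<theta> \<in> signal_class n s a" for \<theta>
      using FDR2[OF that] FNR[OF that] by (simp add: multiple_risk_def)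
  qed
qed

text \<open>The two-sided tails at integer levels decrease to the empty set, so continuity from
  above applies.\<close>

lemma exists_high_threshold:
  assumes "0 < \<epsilon>"
  shows "\<exists>t. measure (obs 0) {x. t < \<bar>x\<bar>} \<le> \<epsilon>"
proof -
  interpret prob_space "obs 0" by (rule prob_space_obs)
  define A where "A k = {x. real k < \<bar>x\<bar>}" for k
  have "(\<lambda>k. measure (obs 0) (A k)) \<longlonglongrightarrow> measure (obs 0) (\<Inter>k. A k)"
  proof (rule finite_Lim_measure_decseq)
    show "range A \<subseteq> sets (obs 0)"
      unfolding A_def by auto
    show "decseq A"
      by (auto simp: A_def decseq_def)
  qed
  moreover have "(\<Inter>k. A k) = {}"
  proof -
    have "x \<notin> (\<Inter>k. A k)" for x
      using real_arch_simple[of "\<bar>x\<bar>"] by (auto simp: A_def not_less)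
    then show ?thesis by blast
  qed
  ultimately have "(\<lambda>k. measure (obs 0) (A k)) \<longlonglongrightarrow> 0"
    by simp
  then have "\<forall>\<^sub>F k in sequentially. measure (obs 0) (A k) < \<epsilon>"
    using assms by (rule order_tendstoD)
  then obtain k where "measure (obs 0) (A k) < \<epsilon>"
    by (auto simp: eventually_sequentially)
  then show ?thesis
    unfolding A_def by (intro exI[of _ "real k"]) simp
qed

end

section \<open>Asymptotics\<close>

text \<open>The integer block length falls short of the ideal one by less than 1, which is harmless
  since tail probabilities are at most 1.\<close>

lemma less_real_div_nat:
  assumes "1 \<le> k"
  shows "real n / real k - 1 < real (n div k)"
proof -
  have "n < k * (n div k) + k"
    using assms mod_less_divisor[of k n] mult_div_mod_eq[of k n] by linarith
  then have "real n < real k * (real (n div k) + 1)"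
    by (simp flip: of_nat_mult of_nat_add add: algebra_simps)
  then show ?thesis
    using assms by (simp add: field_simps)
qed

lemma tendsto_zeroI_between:
  fixes X :: "nat \<Rightarrow> real"
  assumes "\<And>\<epsilon>. 0 < \<epsilon> \<Longrightarrow> \<forall>\<^sub>F n in F. - \<epsilon> \<le> X n \<and> X n \<le> \<epsilon>"
  shows "(X \<longlongrightarrow> 0) F"
proof (rule tendstoI)
  fix e :: real assume "0 < e"
  with assms[of "e / 2"] have "\<forall>\<^sub>F n in F. - (e / 2) \<le> X n \<and> X n \<le> e / 2" by simp
  then show "\<forall>\<^sub>F n in F. dist (X n) 0 < e"
    by eventually_elim (use \<open>0 < e\<close> in auto)
qed

context density_model
begin

text \<open>
  The factor \<open>\<kappa>\<close> counts the sides on which a signal shows up: 1 under alternative A, 2 under B.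
\<close>

lemma sharp_boundary:
  fixes s :: "nat \<Rightarrow> nat" and astar \<delta> :: "nat \<Rightarrow> real" and a :: "nat \<Rightarrow> nat \<Rightarrow> real" and \<kappa> :: real
  assumes s_top: "filterlim s at_top sequentially"
    and ratio_top: "filterlim (\<lambda>n. real n / real (s n)) at_top sequentially"
    and base: "assumption1_base f s astar \<delta>"
    and a: "\<And>n j. 1 \<le> j \<Longrightarrow> j \<le> s n \<Longrightarrow> 0 < a n j"
    and \<kappa>: "1 \<le> \<kappa>"
    and lower: "\<And>n m \<phi> M u. 1 \<le> s n \<Longrightarrow> 1 \<le> m \<Longrightarrow> s n * m \<le> n \<Longrightarrow> \<phi> \<in> testing_procedures n \<Longrightarrow>
        1 \<le> M \<Longrightarrow> 0 < u \<Longrightarrow>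
        1 - 1 / M - \<kappa> * (\<Sum>j=1..s n. surv_fun f (a n j) u) / real (s n)
          - exp (M - real (m - 1) * surv_fun f 0 u / 2)
        \<le> worst_risk f n (signal_class n (s n) (a n)) \<phi>"
    and strong: "\<And>b c t. 0 < b \<Longrightarrow> b \<le> \<bar>c\<bar> \<Longrightarrow> 0 < t \<Longrightarrow>
        \<kappa> * surv_fun f b t \<le> measure (obs c) {x. t < \<bar>x\<bar>}"
    and null: "\<And>t. 0 < t \<Longrightarrow> measure (obs 0) {x. t < \<bar>x\<bar>} \<le> 2 * surv_fun f 0 t"
  defines "\<Theta> \<equiv> \<lambda>n. signal_class n (s n) (a n)"
    and "\<Lambda> \<equiv> \<lambda>n. Lam f (s n) (a n) (astar n)"
  defines "r \<equiv> \<lambda>n. 1 - \<kappa> * (1 - \<Lambda> n)"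
  shows "(\<lambda>n. minimax_risk f n (\<Theta> n) - r n) \<longlonglongrightarrow> 0"
    and "threshold_attains f \<Theta> astar \<Lambda> r"
proof -
  define y where "y n = real n / real (s n) * surv_fun f 0 (astar n - \<delta> n)" for n
  define z where "z n = real n / real (s n) * surv_fun f 0 (astar n)" for n
  define w where "w n t = worst_risk f n (\<Theta> n) (threshold_procedure n t)" for n t
  from base obtain L where lip: "\<And>b. L-lipschitz_on UNIV (dist_fun f b)"
    and astar0: "\<And>n. 0 < astar n" and astar_top: "filterlim astar at_top sequentially"
    and \<delta>0: "\<And>n. 0 < \<delta> n" and \<delta>: "\<delta> \<longlonglongrightarrow> 0"
    and y: "filterlim y at_top sequentially" and z: "z \<longlonglongrightarrow> 0"
    by (auto simp: assumption1_base_def y_def[abs_def] z_def[abs_def])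
  have ev_s: "\<forall>\<^sub>F n in sequentially. 1 \<le> s n"
    using s_top by (simp add: filterlim_at_top)
  have ev_sn: "\<forall>\<^sub>F n in sequentially. s n \<le> n"
  proof -
    have "\<forall>\<^sub>F n in sequentially. 1 \<le> real n / real (s n)"
      using ratio_top by (simp add: filterlim_at_top)
    with ev_s show ?thesis
      by eventually_elim (simp add: field_simps)
  qed
  have Lam_eq: "(\<Sum>j=1..s n. surv_fun f (a n j) (astar n)) / real (s n) = 1 - \<Lambda> n" if "1 \<le> s n" for n
    using that by (simp add: \<Lambda>_def Lam_def surv_fun_def sum_subtractf diff_divide_distrib)

  \<comment> \<open>The index from which the bound holds is common to all procedures, as the infimum
    over them requires.\<close>
  have low: "\<forall>\<^sub>F n in sequentially. \<forall>\<phi>\<in>testing_procedures n. r n - \<epsilon> \<le> worst_risk f n (\<Theta> n) \<phi>"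
    if \<epsilon>: "0 < \<epsilon>" for \<epsilon>
  proof -
    \<comment> \<open>Chosen so that \<open>1 / M\<close>, the Lipschitz correction and the
      exponential term cost at most \<open>\<epsilon> / 4\<close> each.\<close>
    define M where "M = 1 + 4 / \<epsilon>"
    have M: "1 \<le> M" "1 / M \<le> \<epsilon> / 4"
      using \<epsilon> by (auto simp: M_def field_simps)
    have "(\<lambda>n. \<kappa> * (L * \<delta> n)) \<longlonglongrightarrow> \<kappa> * (L * 0)"
      by (intro tendsto_intros \<delta>)
    then have "(\<lambda>n. \<kappa> * (L * \<delta> n)) \<longlonglongrightarrow> 0"
      by simp
    then have ev\<delta>: "\<forall>\<^sub>F n in sequentially. \<kappa> * (L * \<delta> n) < \<epsilon> / 4"
      using \<epsilon> by (intro order_tendstoD) auto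
    \<comment> \<open>Solves \<open>M - (y n - 2) / 2 \<le> ln (\<epsilon> / 4)\<close>. Of the 2
      subtracted from \<open>y n\<close>, one unit pays for rounding the block length and one for
      the coordinate that carries the signal.\<close>
    have evy: "\<forall>\<^sub>F n in sequentially. 2 * (M + 1 - ln (\<epsilon> / 4)) \<le> y n"
      using y by (simp add: filterlim_at_top)
    \<comment> \<open>Together with \<open>\<delta> n < 1\<close> this keeps the level
      \<open>u\<close> positive, as \<open>lower\<close> demands.\<close>
    have eva: "\<forall>\<^sub>F n in sequentially. 1 \<le> astar n"
      using astar_top by (simp add: filterlim_at_top)
    have ev1: "\<forall>\<^sub>F n in sequentially. \<delta> n < 1"
      using \<delta> by (rule order_tendstoD) simp
    show ?thesis
      using ev\<delta> evy eva ev1 ev_s ev_sn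
    proof eventually_elim
      case (elim n)
      note s1 = elim(5)
      define u where "u = astar n - \<delta> n"
      define m where "m = n div s n"
      define p where "p = surv_fun f 0 u"
      have u: "0 < u" using elim by (simp add: u_def)
      have m: "1 \<le> m" "s n * m \<le> n"
        using elim div_le_mono[of "s n" n "s n"] by (auto simp: m_def)
      have p: "0 \<le> p" "p \<le> 1" by (auto simp: p_def surv_fun_bounds)
      define N where "N = real (m - 1)"
      have "real n / real (s n) - 2 \<le> N"
        using less_real_div_nat[OF s1, of n] m by (simp add: N_def m_def of_nat_diff)
      then have "(real n / real (s n) - 2) * p \<le> N * p"
        using p by (intro mult_right_mono) auto
      moreover have "y n - 2 \<le> (real n / real (s n) - 2) * p"
        using p by (simp add: y_def p_def u_def algebra_simps)
      ultimately have "y n - 2 \<le> N * p"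
        by (rule order_trans[rotated])
      then have "M - N * p / 2 \<le> ln (\<epsilon> / 4)"
        using elim(2) by (simp add: field_simps)
      then have "exp (M - N * p / 2) \<le> exp (ln (\<epsilon> / 4))"
        by simp
      then have e: "exp (M - N * p / 2) \<le> \<epsilon> / 4"
        using \<epsilon> by simp
      have "surv_fun f (a n j) u \<le> surv_fun f (a n j) (astar n) + L * \<delta> n" for j
        using lipschitz_onD[OF lip[of "a n j"], of "astar n" u] \<delta>0[of n]
        by (auto simp: surv_fun_def dist_real_def u_def abs_le_iff)
      then have "(\<Sum>j=1..s n. surv_fun f (a n j) u)
          \<le> (\<Sum>j=1..s n. surv_fun f (a n j) (astar n) + L * \<delta> n)"
        by (intro sum_mono)
      then have "(\<Sum>j=1..s n. surv_fun f (a n j) u) / real (s n)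
          \<le> (\<Sum>j=1..s n. surv_fun f (a n j) (astar n) + L * \<delta> n) / real (s n)"
        by (rule divide_right_mono) simp
      also have "\<dots> = 1 - \<Lambda> n + L * \<delta> n"
        using Lam_eq[OF s1] s1 by (simp add: sum.distrib add_divide_distrib)
      finally have "\<kappa> * ((\<Sum>j=1..s n. surv_fun f (a n j) u) / real (s n)) \<le> \<kappa> * (1 - \<Lambda> n + L * \<delta> n)"
        using \<kappa> by (intro mult_left_mono) auto
      then have k: "\<kappa> * (\<Sum>j=1..s n. surv_fun f (a n j) u) / real (s n) \<le> \<kappa> * (1 - \<Lambda> n) + \<kappa> * (L * \<delta> n)"
        by (simp add: algebra_simps)
      show ?case
      proof
        fix \<phi> assume "\<phi> \<in> testing_procedures n"
        from lower[OF s1 m this M(1) u] k e M(2) elim(1) \<epsilon>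
        show "r n - \<epsilon> \<le> worst_risk f n (\<Theta> n) \<phi>"
          unfolding r_def \<Theta>_def p_def N_def by linarith
      qed
    qed
  qed

  have mm_w: "\<forall>\<^sub>F n in sequentially. \<forall>t. minimax_risk f n (\<Theta> n) \<le> w n t"
    using ev_sn
  proof eventually_elim
    case (elim n)
    have "\<Theta> n \<noteq> {}"
      unfolding \<Theta>_def using elim a by (intro signal_class_nonempty) auto
    then show ?case
      unfolding w_def by (intro allI minimax_risk_le_worst_risk threshold_procedure_in_testing_procedures)
  qed

  have low_mm: "\<forall>\<^sub>F n in sequentially. r n - \<epsilon> \<le> minimax_risk f n (\<Theta> n)" if "0 < \<epsilon>" for \<epsilon>
    using low[OF that]
  proof eventually_elim
    case (elim n)
    have "testing_procedures n \<noteq> {}"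
      using threshold_procedure_in_testing_procedures by blast
    then show ?case
      unfolding minimax_risk_def using elim by (intro cINF_greatest) auto
  qed
  have low_w: "\<forall>\<^sub>F n in sequentially. \<forall>t. r n - \<epsilon> \<le> w n t" if "0 < \<epsilon>" for \<epsilon>
    using low[OF that]
    by eventually_elim (simp add: w_def threshold_procedure_in_testing_procedures)

  \<comment> \<open>The condition on \<open>\<Lambda>\<close> stays inside the eventuality, so that
    the statement serves both the restricted filter and a case distinction for each index.\<close>
  have up: "\<forall>\<^sub>F n in sequentially. \<Lambda> n \<le> c \<longrightarrow> w n (astar n) \<le> r n + \<epsilon>"
    if c: "c < 1" and \<epsilon>: "0 < \<epsilon>" for c \<epsilon>
  proof -
    \<comment> \<open>On average at least \<open>(1 - c) * real (s n)\<close> signals are detected.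
      Half of that enters the Chernoff exponent, and a quarter as cutoff leaves
      \<open>- \<eta> * real (s n)\<close>.\<close>
    define \<eta> where "\<eta> = (1 - c) / 4"
    have \<eta>: "0 < \<eta>" using c by (simp add: \<eta>_def)
    have "(\<lambda>n. 2 * z n / \<eta>) \<longlonglongrightarrow> 2 * 0 / \<eta>"
      using \<eta> by (intro tendsto_intros z) auto
    then have "(\<lambda>n. 2 * z n / \<eta>) \<longlonglongrightarrow> 0"
      by simp
    then have evz: "\<forall>\<^sub>F n in sequentially. 2 * z n / \<eta> < \<epsilon> / 2"
      using \<epsilon> by (intro order_tendstoD) auto
    have "filterlim (\<lambda>n. real (s n)) at_top sequentially"
      using filterlim_compose[OF filterlim_real_sequentially s_top] .
    then have evs: "\<forall>\<^sub>F n in sequentially. - ln (\<epsilon> / 2) / \<eta> \<le> real (s n)"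
      by (simp add: filterlim_at_top)
    show ?thesis
      using evz evs ev_s ev_sn
    proof eventually_elim
      case (elim n)
      show ?case
      proof
        assume \<Lambda>: "\<Lambda> n \<le> c"
        define p where "p = measure (obs 0) {x. astar n < \<bar>x\<bar>}"
        define q where "q = (\<Sum>j=1..s n. \<kappa> * surv_fun f (a n j) (astar n))"
        have s0: "0 < real (s n)" using elim(3) by simp
        have w: "w n (astar n) \<le> real n * p / (\<eta> * real (s n)) + exp (\<eta> * real (s n) - q / 2)
            + (1 - q / real (s n))"
          unfolding w_def \<Theta>_def p_def q_def using elim \<eta> a strong astar0
          by (intro threshold_risk_upper) auto
        have qs: "q / real (s n) = \<kappa> * (1 - \<Lambda> n)"
          unfolding q_def sum_distrib_left[symmetric] Lam_eq[OF elim(3), symmetric] by simp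
        have "1 * (1 - c) \<le> \<kappa> * (1 - \<Lambda> n)"
          using \<kappa> \<Lambda> c by (intro mult_mono) auto
        then have "1 - c \<le> q / real (s n)"
          by (simp add: qs)
        then have "(1 - c) * real (s n) \<le> q"
          using s0 by (simp add: le_divide_eq)
        moreover have "- ln (\<epsilon> / 2) \<le> \<eta> * real (s n)"
          using elim(2) \<eta> by (simp add: field_simps)
        ultimately have "\<eta> * real (s n) - q / 2 \<le> ln (\<epsilon> / 2)"
          unfolding \<eta>_def by (simp add: algebra_simps)
        then have "exp (\<eta> * real (s n) - q / 2) \<le> exp (ln (\<epsilon> / 2))"
          by simp
        then have e: "exp (\<eta> * real (s n) - q / 2) \<le> \<epsilon> / 2"
          using \<epsilon> by simp
        have "real n * p / (\<eta> * real (s n)) \<le> real n * (2 * surv_fun f 0 (astar n)) / (\<eta> * real (s n))"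
          unfolding p_def using null[OF astar0] \<eta> s0 by (intro divide_right_mono mult_left_mono) auto
        also have "\<dots> = 2 * z n / \<eta>"
          by (simp add: z_def mult_ac)
        finally have "real n * p / (\<eta> * real (s n)) \<le> 2 * z n / \<eta>" .
        then show "w n (astar n) \<le> r n + \<epsilon>"
          using w e elim(1) qs unfolding r_def by linarith
      qed
    qed
  qed

  \<comment> \<open>The square makes even the expected number of false discoveries among
    \<open>n\<close> coordinates vanish.\<close>
  have "\<exists>t. measure (obs 0) {x. t < \<bar>x\<bar>} \<le> 1 / (real n + 1) ^ 2" for n
    by (intro exists_high_threshold) (simp add: add_nonneg_pos)
  then obtain v where v: "\<And>n. measure (obs 0) {x. v n < \<bar>x\<bar>} \<le> 1 / (real n + 1) ^ 2"
    by metis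
  have up_v: "\<forall>\<^sub>F n in sequentially. w n (v n) \<le> 1 + \<epsilon>" if \<epsilon>: "0 < \<epsilon>" for \<epsilon>
  proof -
    have "\<forall>\<^sub>F n in sequentially. 1 / \<epsilon> \<le> real n"
      using filterlim_real_sequentially by (simp add: filterlim_at_top)
    then show ?thesis
      using ev_s ev_sn
    proof eventually_elim
      case (elim n)
      have "w n (v n) \<le> 1 + real n * measure (obs 0) {x. v n < \<bar>x\<bar>}"
        unfolding w_def \<Theta>_def using elim a
        by (intro threshold_risk_upper(1)[where \<eta>=1 and g="\<lambda>_. 0"]) auto
      also have "\<dots> \<le> 1 + real n * (1 / (real n + 1) ^ 2)"
        using v[of n] by (intro add_left_mono mult_left_mono) auto
      also have "real n * (1 / (real n + 1) ^ 2) \<le> 1 / (real n + 1)"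
        by (simp add: power2_eq_square divide_simps)
      also have "1 / (real n + 1) \<le> \<epsilon>"
      proof -
        have "1 \<le> \<epsilon> * real n" using elim(1) \<epsilon> by (simp add: field_simps)
        also have "\<dots> \<le> \<epsilon> * (real n + 1)" using \<epsilon> by simp
        finally show ?thesis by (simp add: divide_le_eq)
      qed
      finally show ?case by simp
    qed
  qed

  text \<open>Where \<open>\<Lambda>\<close> is close to 1, rejecting almost nothing has risk about 1, which is optimal.\<close>
  define t where "t n = (if w n (astar n) \<le> w n (v n) then astar n else v n)" for n
  have up_t: "\<forall>\<^sub>F n in sequentially. w n (t n) \<le> r n + \<epsilon>" if \<epsilon>: "0 < \<epsilon>" for \<epsilon>
  proof -
    \<comment> \<open>Above this \<open>c\<close> the level \<open>r n\<close> exceeds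
      \<open>1 - \<epsilon> / 2\<close>, which \<open>v n\<close> matches. The cutoff depends on
      \<open>\<epsilon>\<close>, but \<open>t\<close> does not, so one sequence of thresholds serves
      every \<open>\<epsilon>\<close>.\<close>
    define c where "c = 1 - \<epsilon> / (2 * \<kappa>)"
    have c: "c < 1" using \<epsilon> \<kappa> by (simp add: c_def)
    have "\<forall>\<^sub>F n in sequentially. w n (v n) \<le> 1 + \<epsilon> / 2"
      using \<epsilon> by (intro up_v) simp
    with up[OF c \<epsilon>] show ?thesis
    proof eventually_elim
      case (elim n)
      show ?case
      proof (cases "\<Lambda> n \<le> c")
        case True
        then show ?thesis using elim(1) by (auto simp: t_def)
      next
        case False
        then have "\<kappa> * (1 - \<Lambda> n) \<le> \<kappa> * (\<epsilon> / (2 * \<kappa>))"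
          using \<kappa> by (intro mult_left_mono) (auto simp: c_def)
        also have "\<dots> = \<epsilon> / 2" using \<kappa> by simp
        finally show ?thesis
          using elim(2) by (auto simp: t_def r_def)
      qed
    qed
  qed

  show "(\<lambda>n. minimax_risk f n (\<Theta> n) - r n) \<longlonglongrightarrow> 0"
  proof (rule tendsto_zeroI_between)
    fix \<epsilon> :: real assume "0 < \<epsilon>"
    from low_mm[OF this] up_t[OF this] mm_w
    show "\<forall>\<^sub>F n in sequentially. - \<epsilon> \<le> minimax_risk f n (\<Theta> n) - r n \<and> minimax_risk f n (\<Theta> n) - r n \<le> \<epsilon>"
    proof eventually_elim
      case (elim n)
      from elim(3)[rule_format, of "t n"] elim(1,2) show ?case by linarith
    qed
  qed
  show "threshold_attains f \<Theta> astar \<Lambda> r"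
    unfolding threshold_attains_def w_def[symmetric]
  proof (intro conjI allI impI exI[of _ t])
    fix c :: real assume c: "c < 1"
    show "((\<lambda>n. w n (astar n) - r n) \<longlongrightarrow> 0) (inf sequentially (principal {n. \<Lambda> n \<le> c}))"
    proof (rule tendsto_zeroI_between)
      fix \<epsilon> :: real assume "0 < \<epsilon>"
      from low_w[OF this] up[OF c this]
      show "\<forall>\<^sub>F n in inf sequentially (principal {n. \<Lambda> n \<le> c}).
          - \<epsilon> \<le> w n (astar n) - r n \<and> w n (astar n) - r n \<le> \<epsilon>"
        unfolding eventually_inf_principal
      proof eventually_elim
        case (elim n)
        from elim(1)[rule_format, of "astar n"] elim(2) show ?case by auto
      qed
    qed
  next
    show "(\<lambda>n. w n (t n) - r n) \<longlonglongrightarrow> 0"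
    proof (rule tendsto_zeroI_between)
      fix \<epsilon> :: real assume "0 < \<epsilon>"
      from low_w[OF this] up_t[OF this]
      show "\<forall>\<^sub>F n in sequentially. - \<epsilon> \<le> w n (t n) - r n \<and> w n (t n) - r n \<le> \<epsilon>"
      proof eventually_elim
        case (elim n)
        from elim(1)[rule_format, of "t n"] elim(2) show ?case by auto
      qed
    qed
  qed
qed

end

section \<open>The two alternatives: one-sided and two-sided detection\<close>

theorem theorem4:
  fixes f :: "real \<Rightarrow> real \<Rightarrow> real"
    and s :: "nat \<Rightarrow> nat"
    and astar \<delta> :: "nat \<Rightarrow> real"
    and a :: "nat \<Rightarrow> nat \<Rightarrow> real"
  assumes "density_family f"
    and "filterlim s at_top sequentially"
    and "filterlim (\<lambda>n. real n / real (s n)) at_top sequentially"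
    and "assumption1_base f s astar \<delta>"
    and "\<And>n j. 1 \<le> j \<Longrightarrow> j \<le> s n \<Longrightarrow> 0 < a n j"
  defines "\<Theta> \<equiv> \<lambda>n. signal_class n (s n) (a n)"
    and "\<Lambda> \<equiv> \<lambda>n. Lam f (s n) (a n) (astar n)"
  shows "(assumption1_A f \<longrightarrow>
            (\<lambda>n. minimax_risk f n (\<Theta> n) - \<Lambda> n) \<longlonglongrightarrow> 0 \<and>
            threshold_attains f \<Theta> astar \<Lambda> \<Lambda>)
       \<and> (assumption1_B f \<and> negative_signals_as_strong f \<longrightarrow>
            (\<lambda>n. minimax_risk f n (\<Theta> n) - (2 * \<Lambda> n - 1)) \<longlonglongrightarrow> 0 \<and>
            threshold_attains f \<Theta> astar \<Lambda> (\<lambda>n. 2 * \<Lambda> n - 1))"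
proof (rule conjI; rule impI)
  interpret density_model f by unfold_locales fact
  have pos: "0 < f 0 x" for x
    using assms(4) by (simp add: assumption1_base_def)
  have a: "0 < a n j" if "j \<in> {1..s n}" for n j
    using assms(5) that by simp
  note boundary = sharp_boundary[OF assms(2-5)]
  {
    assume "assumption1_A f"
    then have sym: "\<And>b x. f (- b) (- x) = f b x" and inc: "\<And>x. mono (\<lambda>b. surv_fun f b x)"
      and lr: "\<And>b. 0 < b \<Longrightarrow> mono (\<lambda>x. f b x / f 0 x)"
      by (auto simp: assumption1_A_def)
    have refl: "measure (obs b) {..<- t} = surv_fun f (- b) t" for b t
      using sym[of "- b"] by (intro measure_obs_reflect) simp
    \<comment> \<open>The prior only uses positive signals, whose likelihood ratio increases on the
      whole line, so one half-line serves as both \<open>E\<close> and \<open>T\<close>.\<close>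
    have lower: "1 - 1 / M - 1 * (\<Sum>j=1..s n. surv_fun f (a n j) u) / real (s n)
          - exp (M - real (m - 1) * surv_fun f 0 u / 2)
        \<le> worst_risk f n (signal_class n (s n) (a n)) \<phi>"
      if "1 \<le> s n" "1 \<le> m" "s n * m \<le> n" "\<phi> \<in> testing_procedures n" "1 \<le> M" "0 < u"
      for n m \<phi> M u
      using worst_risk_lower[where a="a n" and E="{u<..}" and T="{u<..}", OF pos that(1-3) a that(4,5)] monoD[OF lr[OF a]]
      by (simp add: measure_obs_greaterThan)
    \<comment> \<open>One tail is enough: the right one for \<open>c \<ge> 0\<close>, and for
      \<open>c < 0\<close> the left one, which has the mass of the right tail at
      \<open>- c\<close>.\<close>
    have strong: "1 * surv_fun f b t \<le> measure (obs c) {x. t < \<bar>x\<bar>}"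
      if "0 < b" "b \<le> \<bar>c\<bar>" "0 < t" for b c t
    proof (cases "0 \<le> c")
      case True
      then show ?thesis
        using that monoD[OF inc, of b c t] surv_fun_bounds(1)[of "- c" t]
        by (simp add: measure_obs_two_sided refl)
    next
      case False
      then show ?thesis
        using that monoD[OF inc, of b "- c" t] surv_fun_bounds(1)[of c t]
        by (simp add: measure_obs_two_sided refl)
    qed
    have null: "measure (obs 0) {x. t < \<bar>x\<bar>} \<le> 2 * surv_fun f 0 t" if "0 < t" for t
      using that refl[of 0 t] by (simp add: measure_obs_two_sided)
    show "(\<lambda>n. minimax_risk f n (\<Theta> n) - \<Lambda> n) \<longlonglongrightarrow> 0 \<and> threshold_attains f \<Theta> astar \<Lambda> \<Lambda>"
      using boundary[where \<kappa>=1, OF _ _ _ lower strong null] by (simp add: \<Theta>_def \<Lambda>_def)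
  next
    assume "assumption1_B f \<and> negative_signals_as_strong f"
    then have sym: "\<And>b x. f b (- x) = f b x"
      and inc: "\<And>x. 0 < x \<Longrightarrow> mono_on {0<..} (\<lambda>b. surv_fun f b x)"
      and lr: "\<And>b. b \<noteq> 0 \<Longrightarrow> mono_on {0<..} (\<lambda>x. f b x / f 0 x)"
      and neg: "\<And>b x. 0 < b \<Longrightarrow> 0 < x \<Longrightarrow> surv_fun f b x \<le> surv_fun f (- b) x"
      by (auto simp: assumption1_B_def negative_signals_as_strong_def)
    have two: "measure (obs b) {x. t < \<bar>x\<bar>} = 2 * surv_fun f b t" if "0 \<le> t" for b t
      using measure_obs_reflect[OF sym, of b t] that by (simp add: measure_obs_two_sided)
    have abs: "f b \<bar>x\<bar> = f b x" for b x
      using sym[of b x] by (simp add: abs_if)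
    have lower: "1 - 1 / M - 2 * (\<Sum>j=1..s n. surv_fun f (a n j) u) / real (s n)
          - exp (M - real (m - 1) * surv_fun f 0 u / 2)
        \<le> worst_risk f n (signal_class n (s n) (a n)) \<phi>"
      if "1 \<le> s n" "1 \<le> m" "s n * m \<le> n" "\<phi> \<in> testing_procedures n" "1 \<le> M" "0 < u"
      for n m \<phi> M u
    proof -
      let ?T = "{x::real. u < \<bar>x\<bar>}"
      \<comment> \<open>By symmetry the ratio depends on the absolute value only. Its monotonicity
        is given away from the origin, so 0 is put into \<open>E\<close>, at no cost in
        probability.\<close>
      have "f (a n j) x / f 0 x \<le> f (a n j) y / f 0 y"
        if j: "j \<in> {1..s n}" and "x \<notin> insert 0 ?T" "y \<in> ?T" for j x y
      proof -
        have "f (a n j) \<bar>x\<bar> / f 0 \<bar>x\<bar> \<le> f (a n j) \<bar>y\<bar> / f 0 \<bar>y\<bar>"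
          using that \<open>0 < u\<close> a[OF j] by (intro mono_onD[OF lr]) auto
        then show ?thesis by (simp only: abs)
      qed
      then have "1 - 1 / M - (\<Sum>j=1..s n. measure (obs (a n j)) (insert 0 ?T)) / real (s n)
          - exp (M - real (m - 1) * measure (obs 0) ?T / 2)
        \<le> worst_risk f n (signal_class n (s n) (a n)) \<phi>"
        by (intro worst_risk_lower[where a="a n", OF pos that(1-3) a that(4,5)]) auto
      \<comment> \<open>Halving the null mass only enlarges the exponential and yields the one-sided
        form common to both alternatives.\<close>
      moreover have "real (m - 1) * surv_fun f 0 u \<le> real (m - 1) * (2 * surv_fun f 0 u)"
        using surv_fun_bounds(1)[of 0 u] by (intro mult_left_mono) auto
      then have "exp (M - real (m - 1) * measure (obs 0) ?T / 2)
          \<le> exp (M - real (m - 1) * surv_fun f 0 u / 2)"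
        using \<open>0 < u\<close> by (simp add: two)
      moreover have "(\<Sum>j=1..s n. measure (obs (a n j)) (insert 0 ?T)) / real (s n)
          = 2 * (\<Sum>j=1..s n. surv_fun f (a n j) u) / real (s n)"
        using \<open>0 < u\<close> by (simp add: measure_obs_insert two sum_distrib_left)
      ultimately show ?thesis by linarith
    qed
    \<comment> \<open>Both tails have equal mass, hence the factor 2. For \<open>c < 0\<close>
      monotonicity in the parameter leads to \<open>- c\<close>, and \<open>neg\<close> carries the
      bound over to \<open>c\<close>.\<close>
    have strong: "2 * surv_fun f b t \<le> measure (obs c) {x. t < \<bar>x\<bar>}"
      if "0 < b" "b \<le> \<bar>c\<bar>" "0 < t" for b c t
    proof (cases "0 \<le> c")
      case True
      then show ?thesis
        using that mono_onD[OF inc, of t b c] by (simp add: two)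
    next
      case False
      then show ?thesis
        using that mono_onD[OF inc, of t b "- c"] neg[of "- c" t] by (simp add: two)
    qed
    have null: "measure (obs 0) {x. t < \<bar>x\<bar>} \<le> 2 * surv_fun f 0 t" if "0 < t" for t
      using that by (simp add: two)
    have "(\<lambda>n. 1 - 2 * (1 - \<Lambda> n)) = (\<lambda>n. 2 * \<Lambda> n - 1)"
      by (auto simp: algebra_simps)
    then show "(\<lambda>n. minimax_risk f n (\<Theta> n) - (2 * \<Lambda> n - 1)) \<longlonglongrightarrow> 0 \<and>
        threshold_attains f \<Theta> astar \<Lambda> (\<lambda>n. 2 * \<Lambda> n - 1)"
      using boundary[where \<kappa>=2, OF _ _ _ lower strong null] by (simp add: \<Theta>_def \<Lambda>_def fun_eq_iff)
  }
qed

end
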